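(* Let $\lambda\in\mathbb R$, $\lambda\notin\mathrm{Sp}(-\nabla\mathrm{div})$, let $k,m\ge0$ be integers and let $\mathbf f=\mathbf f_{\mathcal A}+\mathbf f_{\mathbf V}\in\mathbf C(2k,m)\subset\mathbf L_2(\Omega)$. The problem of finding $\mathbf w\in\mathbf L_2(\Omega)$ with $$\nabla\mathrm{div}\,\mathbf w+\lambda\mathbf w=\mathbf f\ \text{ in }\Omega,\qquad \gamma(\mathbf n\cdot\mathbf w)=0\ \text{ (if this trace exists)}$$ has a unique solution, and it has the form $$\mathbf w=\mathbf w_{\mathcal A}+\mathbf w_{\mathbf V},\qquad \mathbf w_{\mathcal A}=(\mathcal N_d+\lambda I)^{-1}\mathbf f_{\mathcal A},\qquad \mathbf w_{\mathbf V}=\lambda^{-1}\mathbf f_{\mathbf V}.$$ This solution belongs to $\mathbf C(2(k+1),m)=\mathbf A^{2(k+1)}(\Omega)\oplus\mathbf W^m(\Omega)$. In particular: $\mathbf w=(\mathcal N_d+\lambda I)^{-1}\mathbf f_{\mathcal A}\in\mathbf A^2(\Omega)$ if $\mathbf f_{\mathcal A}\in\mathcal A_\gamma$ and $\mathbf f_{\mathbf V}=0$; and $\mathbf w=\lambda^{-1}\mathbf f_{\mathbf V}$ if $\mathbf f_{\mathcal A}=0$ and $\mathbf f_{\mathbf V}\in\mathcal B$.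
   Context: $\Omega\subset\mathbb R^3$ is a bounded domain with smooth boundary, homeomorphic to a ball; $\mathbf n$ is the unit normal, $\gamma$ the boundary trace; $\mathbf L_2(\Omega)$ is the real Hilbert space of square integrable vector fields with inner product $(\cdot,\cdot)$. $\mathcal A=\{\nabla h:h\in H^1(\Omega)\}$, $\mathcal A_\gamma=\{\nabla h:h\in H^2(\Omega),\ \gamma(\mathbf n\cdot\nabla)h=0\}$, and $\mathcal B=\mathbf V^0$ is the orthogonal complement of $\mathcal A$ in $\mathbf L_2(\Omega)$; $\mathbf f_{\mathcal A}$, $\mathbf f_{\mathbf V}$ are the orthogonal projections of $\mathbf f$ on $\mathcal A$, $\mathbf V^0$. $\{\mathbf q_j\}$ is an orthonormal basis of $\mathcal A$ with $\mathbf q_j\in\mathbf C^\infty(\overline\Omega)$, $-\nabla\mathrm{div}\,\mathbf q_j=\nu_j^2\mathbf q_j$, $\gamma(\mathbf n\cdot\mathbf q_j)=0$, $0<\nu_1^2\le\nu_2^2\le\dots$. For $k\ge0$, $\mathbf A^{2k}=\{\mathbf f\in\mathcal A:\sum_j\nu_j^{4k}(\mathbf f,\mathbf q_j)^2<\infty\}$. $\mathcal N_d$, with domain $\mathbf A^2$, is the self-adjoint extension of $\nabla\mathrm{div}$: $\mathcal N_d\mathbf f=-\sum_j\nu_j^2(\mathbf f,\mathbf q_j)\mathbf q_j$. For $m\ge1$, $\mathbf W^m=\{\mathbf f\in\mathbf V^0,\ \mathrm{rot}\,\mathbf f\in\mathbf V^0,\dots,\mathrm{rot}^m\mathbf f\in\mathbf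 V^0\}$, $\mathbf W^0=\mathbf V^0$. $\mathbf C(2k,m)=\mathbf A^{2k}\oplus\mathbf W^m$. The problem is understood via the extension $\mathcal N_d$, i.e. as the pair of projected equations $(\mathcal N_d+\lambda I)\mathbf w_{\mathcal A}=\mathbf f_{\mathcal A}$ (with $\mathbf w_{\mathcal A}\in\mathbf A^2$) and $\lambda\mathbf w_{\mathbf V}=\mathbf f_{\mathbf V}$. $\mathrm{Sp}(-\nabla\mathrm{div})$ is the set of real $\mu$ for which $-\nabla\mathrm{div}\,\mathbf v=\mu\mathbf v$ in $\Omega$, $\gamma(\mathbf n\cdot\mathbf v)=0$, has a nonzero solution, i.e. $\{0\}\cup\{\nu_j^2\}$. *)

theory Defs
  imports "HOL-Analysis.Analysis"
begin

section \<open>Classical differential operators on $R^3$\<close>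

definition pd :: "3 \<Rightarrow> (real^3 \<Rightarrow> 'a::real_normed_vector) \<Rightarrow> real^3 \<Rightarrow> 'a" where
  "pd i f x = frechet_derivative f (at x) (axis i 1)"

fun Ck_on :: "nat \<Rightarrow> (real^3) set \<Rightarrow> (real^3 \<Rightarrow> 'a::real_normed_vector) \<Rightarrow> bool" where
  "Ck_on 0 U f \<longleftrightarrow> continuous_on U f"
| "Ck_on (Suc k) U f \<longleftrightarrow> (\<forall>x\<in>U. f differentiable at x) \<and> (\<forall>i. Ck_on k U (pd i f))"

definition smooth_on :: "(real^3) set \<Rightarrow> (real^3 \<Rightarrow> 'a::real_normed_vector) \<Rightarrow> bool" where
  "smooth_on U f \<longleftrightarrow> (\<forall>k. Ck_on k U f)"

text \<open>Smoothness up to the boundary: the function itself (not merely its restriction to the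
  domain) is smooth on a neighbourhood of the closure, so its boundary values can be read off
  pointwise.\<close>
definition smooth_up_to_boundary :: "(real^3) set \<Rightarrow> (real^3 \<Rightarrow> 'a::real_normed_vector) \<Rightarrow> bool" where
  "smooth_up_to_boundary \<Omega> f \<longleftrightarrow> (\<exists>U. open U \<and> closure \<Omega> \<subseteq> U \<and> smooth_on U f)"

definition test_fun :: "(real^3) set \<Rightarrow> (real^3 \<Rightarrow> 'a::real_normed_vector) \<Rightarrow> bool" where
  "test_fun \<Omega> \<phi> \<longleftrightarrow> smooth_on UNIV \<phi> \<and> compact (closure {x. \<phi> x \<noteq> 0}) \<and> closure {x. \<phi> x \<noteq> 0} \<subseteq> \<Omega>"

definition grad :: "(real^3 \<Rightarrow> real) \<Rightarrow> real^3 \<Rightarrow> real^3" where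
  "grad h x = (\<chi> i. pd i h x)"

definition divg :: "(real^3 \<Rightarrow> real^3) \<Rightarrow> real^3 \<Rightarrow> real" where
  "divg v x = (\<Sum>i\<in>UNIV. pd i (\<lambda>y. v y $ i) x)"

definition rot :: "(real^3 \<Rightarrow> real^3) \<Rightarrow> real^3 \<Rightarrow> real^3" where
  "rot v x = vector
     [pd 2 (\<lambda>y. v y $ 3) x - pd 3 (\<lambda>y. v y $ 2) x,
      pd 3 (\<lambda>y. v y $ 1) x - pd 1 (\<lambda>y. v y $ 3) x,
      pd 1 (\<lambda>y. v y $ 2) x - pd 2 (\<lambda>y. v y $ 1) x]"

section \<open>Domains with smooth boundary\<close>

definition boundary_chart :: "(real^3) set \<Rightarrow> (real^3) set \<Rightarrow> (real^3 \<Rightarrow> real) \<Rightarrow> bool" where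
  "boundary_chart \<Omega> U \<rho> \<longleftrightarrow>
     open U \<and> smooth_on U \<rho> \<and> (\<forall>y\<in>U. grad \<rho> y \<noteq> 0) \<and> \<Omega> \<inter> U = {y\<in>U. \<rho> y < 0}"

definition smooth_ball_domain :: "(real^3) set \<Rightarrow> bool" where
  "smooth_ball_domain \<Omega> \<longleftrightarrow>
     open \<Omega> \<and> connected \<Omega> \<and> bounded \<Omega> \<and> \<Omega> homeomorphic ball (0::real^3) 1 \<and>
     (\<forall>x\<in>frontier \<Omega>. \<exists>U \<rho>. x \<in> U \<and> boundary_chart \<Omega> U \<rho>)"

text \<open>Outward unit normal; the value does not depend on the chart.\<close>
definition unit_normal :: "(real^3) set \<Rightarrow> real^3 \<Rightarrow> real^3" where
  "unit_normal \<Omega> x =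
     (THE n. \<exists>U \<rho>. x \<in> U \<and> boundary_chart \<Omega> U \<rho> \<and> n = grad \<rho> x /\<^sub>R norm (grad \<rho> x))"

section \<open>Square integrable fields\<close>

text \<open>Elements of $L_2$ are represented by functions on the whole space, of which only the
  values in the domain matter; equality is equality almost everywhere in the domain.\<close>

definition L2 :: "(real^3) set \<Rightarrow> (real^3 \<Rightarrow> 'a::euclidean_space) set" where
  "L2 \<Omega> = {f \<in> borel_measurable (lebesgue_on \<Omega>).
              integrable (lebesgue_on \<Omega>) (\<lambda>x. (norm (f x))\<^sup>2)}"

definition L2_eq :: "(real^3) set \<Rightarrow> (real^3 \<Rightarrow> 'a::euclidean_space) \<Rightarrow> (real^3 \<Rightarrow> 'a) \<Rightarrow> bool" where
  "L2_eq \<Omega> f g \<longleftrightarrow> (AE x in lebesgue_on \<Omega>. f x = g x)"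

definition L2_inner :: "(real^3) set \<Rightarrow> (real^3 \<Rightarrow> 'a::euclidean_space) \<Rightarrow> (real^3 \<Rightarrow> 'a) \<Rightarrow> real" where
  "L2_inner \<Omega> f g = (\<integral>x. f x \<bullet> g x \<partial>lebesgue_on \<Omega>)"

definition L2_norm :: "(real^3) set \<Rightarrow> (real^3 \<Rightarrow> 'a::euclidean_space) \<Rightarrow> real" where
  "L2_norm \<Omega> f = sqrt (L2_inner \<Omega> f f)"

text \<open>Sum of a series of fields converging in $L_2$ (some representative of it).\<close>
definition L2_suminf :: "(real^3) set \<Rightarrow> (nat \<Rightarrow> real^3 \<Rightarrow> real^3) \<Rightarrow> real^3 \<Rightarrow> real^3" where
  "L2_suminf \<Omega> s =
     (SOME g. g \<in> L2 \<Omega> \<and> (\<lambda>n. L2_norm \<Omega> (\<lambda>x. (\<Sum>j<n. s j x) - g x)) \<longlonglongrightarrow> 0)"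

definition orth_compl :: "(real^3) set \<Rightarrow> (real^3 \<Rightarrow> real^3) set \<Rightarrow> (real^3 \<Rightarrow> real^3) set" where
  "orth_compl \<Omega> S = {f \<in> L2 \<Omega>. \<forall>s\<in>S. L2_inner \<Omega> f s = 0}"

definition is_orth_proj ::
  "(real^3) set \<Rightarrow> (real^3 \<Rightarrow> real^3) set \<Rightarrow> (real^3 \<Rightarrow> real^3) \<Rightarrow> (real^3 \<Rightarrow> real^3) \<Rightarrow> bool" where
  "is_orth_proj \<Omega> S f g \<longleftrightarrow> g \<in> S \<and> (\<lambda>x. f x - g x) \<in> orth_compl \<Omega> S"

definition closed_span :: "(real^3) set \<Rightarrow> (nat \<Rightarrow> real^3 \<Rightarrow> real^3) \<Rightarrow> (real^3 \<Rightarrow> real^3) set" where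
  "closed_span \<Omega> q = {f \<in> L2 \<Omega>. \<forall>\<epsilon>>0. \<exists>n c. L2_norm \<Omega> (\<lambda>x. f x - (\<Sum>j<n. c j *\<^sub>R q j x)) < \<epsilon>}"

definition orthonormal_basis ::
  "(real^3) set \<Rightarrow> (real^3 \<Rightarrow> real^3) set \<Rightarrow> (nat \<Rightarrow> real^3 \<Rightarrow> real^3) \<Rightarrow> bool" where
  "orthonormal_basis \<Omega> S q \<longleftrightarrow>
     (\<forall>j. q j \<in> S) \<and> (\<forall>i j. L2_inner \<Omega> (q i) (q j) = (if i = j then 1 else 0)) \<and>
     closed_span \<Omega> q = S"

section \<open>Weak derivatives and Sobolev spaces\<close>

definition weak_pd :: "(real^3) set \<Rightarrow> 3 \<Rightarrow> (real^3 \<Rightarrow> real) \<Rightarrow> (real^3 \<Rightarrow> real) \<Rightarrow> bool" where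
  "weak_pd \<Omega> i h g \<longleftrightarrow> h \<in> L2 \<Omega> \<and> g \<in> L2 \<Omega> \<and>
     (\<forall>\<phi>. test_fun \<Omega> \<phi> \<longrightarrow> L2_inner \<Omega> h (pd i \<phi>) = - L2_inner \<Omega> g \<phi>)"

definition weak_grad :: "(real^3) set \<Rightarrow> (real^3 \<Rightarrow> real) \<Rightarrow> (real^3 \<Rightarrow> real^3) \<Rightarrow> bool" where
  "weak_grad \<Omega> h g \<longleftrightarrow> (\<forall>i. weak_pd \<Omega> i h (\<lambda>x. g x $ i))"

definition weak_rot :: "(real^3) set \<Rightarrow> (real^3 \<Rightarrow> real^3) \<Rightarrow> (real^3 \<Rightarrow> real^3) \<Rightarrow> bool" where
  "weak_rot \<Omega> f g \<longleftrightarrow> f \<in> L2 \<Omega> \<and> g \<in> L2 \<Omega> \<and>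
     (\<forall>\<phi>. test_fun \<Omega> \<phi> \<longrightarrow> L2_inner \<Omega> f (rot \<phi>) = L2_inner \<Omega> g \<phi>)"

definition H1 :: "(real^3) set \<Rightarrow> (real^3 \<Rightarrow> real) set" where
  "H1 \<Omega> = {h \<in> L2 \<Omega>. \<exists>g. weak_grad \<Omega> h g}"

definition H2 :: "(real^3) set \<Rightarrow> (real^3 \<Rightarrow> real) set" where
  "H2 \<Omega> = {h \<in> L2 \<Omega>. \<exists>g. weak_grad \<Omega> h g \<and> (\<forall>i. (\<lambda>x. g x $ i) \<in> H1 \<Omega>)}"

section \<open>Boundary traces\<close>

text \<open>Two-dimensional Hausdorff measure, normalised to agree with surface area. As a metric outer
  measure it is countably additive on the Borel sets.\<close>

definition hausdorff2 :: "(real^3) set \<Rightarrow> ennreal" where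
  "hausdorff2 A = (SUP \<delta>\<in>{0<..}.
     INF U \<in> {U :: nat \<Rightarrow> (real^3) set.
                A \<subseteq> (\<Union>i. U i) \<and> (\<forall>i. bounded (U i) \<and> diameter (U i) \<le> \<delta>)}.
       (\<Sum>i. ennreal (pi / 4 * (diameter (U i))\<^sup>2)))"

definition surface_measure :: "(real^3) set \<Rightarrow> (real^3) measure" where
  "surface_measure \<Omega> =
     restrict_space (measure_of UNIV (sets borel) hausdorff2) (frontier \<Omega>)"

text \<open>The trace of a function in $H^1$ is obtained by continuous extension of the restriction
  to the boundary from functions smooth up to the boundary.\<close>
definition has_trace :: "(real^3) set \<Rightarrow> (real^3 \<Rightarrow> real) \<Rightarrow> (real^3 \<Rightarrow> real) \<Rightarrow> bool" where
  "has_trace \<Omega> u t \<longleftrightarrow> t \<in> borel_measurable (surface_measure \<Omega>) \<and>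
     (\<exists>\<phi> g. weak_grad \<Omega> u g \<and> (\<forall>n. smooth_up_to_boundary \<Omega> (\<phi> n)) \<and>
        (\<lambda>n. L2_norm \<Omega> (\<lambda>x. \<phi> n x - u x)) \<longlonglongrightarrow> 0 \<and>
        (\<lambda>n. L2_norm \<Omega> (\<lambda>x. grad (\<phi> n) x - g x)) \<longlonglongrightarrow> 0 \<and>
        (\<lambda>n. \<integral>\<^sup>+x. ennreal ((\<phi> n x - t x)\<^sup>2) \<partial>surface_measure \<Omega>) \<longlonglongrightarrow> 0)"

definition zero_normal_trace :: "(real^3) set \<Rightarrow> (real^3 \<Rightarrow> real^3) \<Rightarrow> bool" where
  "zero_normal_trace \<Omega> v \<longleftrightarrow>
     (\<exists>t. (\<forall>i. has_trace \<Omega> (\<lambda>x. v x $ i) (\<lambda>x. t x $ i)) \<and>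
          (AE x in surface_measure \<Omega>. unit_normal \<Omega> x \<bullet> t x = 0))"

text \<open>Boundary condition for fields continuous up to the boundary.\<close>
definition tangential :: "(real^3) set \<Rightarrow> (real^3 \<Rightarrow> real^3) \<Rightarrow> bool" where
  "tangential \<Omega> v \<longleftrightarrow> (\<forall>x\<in>frontier \<Omega>. unit_normal \<Omega> x \<bullet> v x = 0)"

section \<open>The function spaces and the operator\<close>

definition potential_fields :: "(real^3) set \<Rightarrow> (real^3 \<Rightarrow> real^3) set" where
  "potential_fields \<Omega> = {f \<in> L2 \<Omega>. \<exists>h\<in>H1 \<Omega>. weak_grad \<Omega> h f}"

definition potential_fields_\<gamma> :: "(real^3) set \<Rightarrow> (real^3 \<Rightarrow> real^3) set" where
  "potential_fields_\<gamma> \<Omega> = {f \<in> L2 \<Omega>. \<exists>h\<in>H2 \<Omega>. weak_grad \<Omega> h f \<and> zero_normal_trace \<Omega> f}"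

definition V0 :: "(real^3) set \<Rightarrow> (real^3 \<Rightarrow> real^3) set" where
  "V0 \<Omega> = orth_compl \<Omega> (potential_fields \<Omega>)"

text \<open>The sequence \<open>r\<close> lists the iterated rotors of \<open>f\<close>.\<close>
definition W_space :: "(real^3) set \<Rightarrow> nat \<Rightarrow> (real^3 \<Rightarrow> real^3) set" where
  "W_space \<Omega> m = {f. \<exists>r. r 0 = f \<and> (\<forall>i\<le>m. r i \<in> V0 \<Omega>) \<and> (\<forall>i<m. weak_rot \<Omega> (r i) (r (Suc i)))}"

definition A_space ::
  "(real^3) set \<Rightarrow> (nat \<Rightarrow> real^3 \<Rightarrow> real^3) \<Rightarrow> (nat \<Rightarrow> real) \<Rightarrow> nat \<Rightarrow> (real^3 \<Rightarrow> real^3) set" where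
  "A_space \<Omega> q \<nu> s =
     {f \<in> potential_fields \<Omega>. summable (\<lambda>j. \<nu> j ^ (2 * s) * (L2_inner \<Omega> f (q j))\<^sup>2)}"

definition C_space ::
  "(real^3) set \<Rightarrow> (nat \<Rightarrow> real^3 \<Rightarrow> real^3) \<Rightarrow> (nat \<Rightarrow> real) \<Rightarrow> nat \<Rightarrow> nat \<Rightarrow> (real^3 \<Rightarrow> real^3) set" where
  "C_space \<Omega> q \<nu> s m =
     {f \<in> L2 \<Omega>. \<exists>a\<in>A_space \<Omega> q \<nu> s. \<exists>b\<in>W_space \<Omega> m. L2_eq \<Omega> f (\<lambda>x. a x + b x)}"

text \<open>The self-adjoint extension of grad div, to be applied to elements of
  \<open>A_space \<Omega> q \<nu> 2\<close> only.\<close>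
definition Nd ::
  "(real^3) set \<Rightarrow> (nat \<Rightarrow> real^3 \<Rightarrow> real^3) \<Rightarrow> (nat \<Rightarrow> real) \<Rightarrow> (real^3 \<Rightarrow> real^3) \<Rightarrow> real^3 \<Rightarrow> real^3" where
  "Nd \<Omega> q \<nu> f = (\<lambda>x. - L2_suminf \<Omega> (\<lambda>j y. ((\<nu> j)\<^sup>2 * L2_inner \<Omega> f (q j)) *\<^sub>R q j y) x)"

text \<open>The inverse of the shifted operator, up to equality almost everywhere.\<close>
definition Nd_shift_inv ::
  "(real^3) set \<Rightarrow> (nat \<Rightarrow> real^3 \<Rightarrow> real^3) \<Rightarrow> (nat \<Rightarrow> real) \<Rightarrow> real \<Rightarrow> (real^3 \<Rightarrow> real^3) \<Rightarrow> real^3 \<Rightarrow> real^3" where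
  "Nd_shift_inv \<Omega> q \<nu> \<mu> g =
     (SOME u. u \<in> A_space \<Omega> q \<nu> 2 \<and> L2_eq \<Omega> (\<lambda>x. Nd \<Omega> q \<nu> u x + \<mu> *\<^sub>R u x) g)"

definition Sp_grad_div :: "(real^3) set \<Rightarrow> real set" where
  "Sp_grad_div \<Omega> = {\<mu>. \<exists>v. Ck_on 2 \<Omega> v \<and> continuous_on (closure \<Omega>) v \<and> (\<exists>x\<in>\<Omega>. v x \<noteq> 0) \<and>
     (\<forall>x\<in>\<Omega>. - grad (divg v) x = \<mu> *\<^sub>R v x) \<and> tangential \<Omega> v}"

text \<open>Solution of \<open>grad div w + \<mu> w = f\<close> with zero normal trace, understood through the
  extension: the projections of \<open>w\<close> and \<open>f\<close> satisfy the two projected equations. The boundary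
  condition is carried by the domain of the extension.\<close>
definition solves_problem ::
  "(real^3) set \<Rightarrow> (nat \<Rightarrow> real^3 \<Rightarrow> real^3) \<Rightarrow> (nat \<Rightarrow> real) \<Rightarrow> real \<Rightarrow>
     (real^3 \<Rightarrow> real^3) \<Rightarrow> (real^3 \<Rightarrow> real^3) \<Rightarrow> bool" where
  "solves_problem \<Omega> q \<nu> \<mu> f w \<longleftrightarrow> w \<in> L2 \<Omega> \<and>
     (\<exists>fA fV wA wV.
        is_orth_proj \<Omega> (potential_fields \<Omega>) f fA \<and> is_orth_proj \<Omega> (V0 \<Omega>) f fV \<and>
        is_orth_proj \<Omega> (potential_fields \<Omega>) w wA \<and> is_orth_proj \<Omega> (V0 \<Omega>) w wV \<and>
        wA \<in> A_space \<Omega> q \<nu> 2 \<and>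
        L2_eq \<Omega> (\<lambda>x. Nd \<Omega> q \<nu> wA x + \<mu> *\<^sub>R wA x) fA \<and>
        L2_eq \<Omega> (\<lambda>x. \<mu> *\<^sub>R wV x) fV)"

end

theory Submission
  imports Defs
begin

text \<open>Along the eigenfields the first projected equation reads
  \<open>(\<mu> - \<nu>\<^sub>j\<^sup>2) w\<^sub>j = f\<^sub>j\<close>, so everything reduces to keeping \<open>\<mu>\<close> at positive distance from the
  \<open>\<nu>\<^sub>j\<^sup>2\<close>. They differ from \<open>\<mu>\<close> because each belongs to the spectrum, and \<open>\<mu> \<noteq> 0\<close> because a
  compactly supported rotation field is an eigenfield for \<open>0\<close>.

  That \<open>\<nu>\<^sub>j\<^sup>2\<close> does not accumulate at \<open>\<mu>\<close> follows without Rellich compactness: if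
  \<open>\<nu>\<^sub>j\<^sup>2 \<le> b\<close> for all \<open>j\<close>, expanding \<open>\<nabla>\<phi>\<close> for a compactly supported \<open>\<phi>\<close> gives
  \<open>\<parallel>\<Delta>\<phi>\<parallel>\<^sup>2 = - (\<nabla>\<Delta>\<phi>, \<nabla>\<phi>) = \<Sum>\<^sub>j \<nu>\<^sub>j\<^sup>2 (\<nabla>\<phi>, q\<^sub>j)\<^sup>2 \<le> b \<parallel>\<nabla>\<phi>\<parallel>\<^sup>2\<close>, whereas
  \<open>\<parallel>\<nabla>\<phi>\<parallel>\<^sup>2 \<le> 4 r\<^sup>2 \<parallel>\<Delta>\<phi>\<parallel>\<^sup>2\<close> when \<open>\<phi>\<close> is supported in a ball of small radius \<open>r\<close>.\<close>

section \<open>The space of square integrable fields\<close>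

text \<open>Fields are functions, not classes, and \<open>L2_suminf\<close> and
  \<open>Nd_shift_inv\<close> are arbitrary choices, about which nothing is known until a witness
  exists. Hence completeness and the Riesz-Fischer theorem come before any spectral argument;
  afterwards fields of the closed span are compared through their coefficients, and identities hold
  almost everywhere.

  The distance from \<mu> to the eigenvalues is measured relative to 1 + \<nu>_j^2. This relative
  form makes the inverse bounded and at the same time lets the quotient absorb \<nu>_j^2, which is
  the gain of two orders. Once the eigenvalues are unbounded and increasing, only finitely many
  indices can make the ratio small, and each of these gives a positive number.

  Pairing eigenfields with general fields would produce boundary terms. They are paired only with
  fields supported in a small ball inside the domain, so each integration by parts becomes one over
  the whole space. The highest derivative taken is the gradient of the Laplacian, so a function of
  class C^3 is enough, and a truncated power of a quadratic polynomial provides it.\<close>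

lemma L2_measurable: "f \<in> L2 \<Omega> \<Longrightarrow> f \<in> borel_measurable (lebesgue_on \<Omega>)"
  by (simp add: L2_def)

lemma L2_inner_integrable:
  assumes "f \<in> L2 \<Omega>" "g \<in> L2 \<Omega>"
  shows "integrable (lebesgue_on \<Omega>) (\<lambda>x. f x \<bullet> g x)"
proof (rule Bochner_Integration.integrable_bound)
  show "integrable (lebesgue_on \<Omega>) (\<lambda>x. (norm (f x))\<^sup>2 + (norm (g x))\<^sup>2)"
    using assms by (simp add: L2_def)
  show "(\<lambda>x. f x \<bullet> g x) \<in> borel_measurable (lebesgue_on \<Omega>)"
    using assms by (auto simp: L2_def)
  have "\<bar>f x \<bullet> g x\<bar> \<le> (norm (f x))\<^sup>2 + (norm (g x))\<^sup>2" for x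
  proof -
    have "\<bar>f x \<bullet> g x\<bar> \<le> norm (f x) * norm (g x)" by (rule Cauchy_Schwarz_ineq2)
    moreover have "0 \<le> (norm (f x) - norm (g x))\<^sup>2" by simp
    moreover have "0 \<le> norm (f x) * norm (g x)" by simp
    ultimately show ?thesis by (simp add: power2_diff)
  qed
  then show "AE x in lebesgue_on \<Omega>. norm (f x \<bullet> g x) \<le> norm ((norm (f x))\<^sup>2 + (norm (g x))\<^sup>2)"
    by simp
qed

lemma L2_iff_integrable_inner:
  "f \<in> L2 \<Omega> \<longleftrightarrow> f \<in> borel_measurable (lebesgue_on \<Omega>) \<and> integrable (lebesgue_on \<Omega>) (\<lambda>x. f x \<bullet> f x)"
  by (simp add: L2_def power2_norm_eq_inner)

lemma L2_zero: "(\<lambda>x. 0) \<in> L2 \<Omega>"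
  by (simp add: L2_def)

lemma L2_scaleR: "f \<in> L2 \<Omega> \<Longrightarrow> (\<lambda>x. c *\<^sub>R f x) \<in> L2 \<Omega>"
  by (auto simp: L2_iff_integrable_inner)

lemma L2_add:
  assumes f: "f \<in> L2 \<Omega>" and g: "g \<in> L2 \<Omega>"
  shows "(\<lambda>x. f x + g x) \<in> L2 \<Omega>"
proof -
  have "integrable (lebesgue_on \<Omega>) (\<lambda>x. f x \<bullet> f x + f x \<bullet> g x + (g x \<bullet> f x + g x \<bullet> g x))"
    by (intro Bochner_Integration.integrable_add L2_inner_integrable assms)
  then show ?thesis
    using f g by (auto simp: L2_iff_integrable_inner inner_add_left inner_add_right add_ac)
qed

lemma L2_uminus: "f \<in> L2 \<Omega> \<Longrightarrow> (\<lambda>x. - f x) \<in> L2 \<Omega>"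
  using L2_scaleR[of f \<Omega> "-1"] by simp

lemma L2_diff: "f \<in> L2 \<Omega> \<Longrightarrow> g \<in> L2 \<Omega> \<Longrightarrow> (\<lambda>x. f x - g x) \<in> L2 \<Omega>"
  using L2_add[of f \<Omega> "\<lambda>x. - g x"] L2_uminus[of g \<Omega>] by simp

lemma L2_sum: "(\<And>i. i \<in> I \<Longrightarrow> f i \<in> L2 \<Omega>) \<Longrightarrow> (\<lambda>x. \<Sum>i\<in>I. f i x) \<in> L2 \<Omega>"
  by (induction I rule: infinite_finite_induct) (auto intro: L2_zero L2_add)

lemmas L2_intros = L2_zero L2_scaleR L2_add L2_uminus L2_diff L2_sum

lemma L2_inner_commute: "L2_inner \<Omega> f g = L2_inner \<Omega> g f"
  by (simp add: L2_inner_def inner_commute)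

lemma L2_inner_add_left:
  "f \<in> L2 \<Omega> \<Longrightarrow> g \<in> L2 \<Omega> \<Longrightarrow> h \<in> L2 \<Omega> \<Longrightarrow>
    L2_inner \<Omega> (\<lambda>x. f x + g x) h = L2_inner \<Omega> f h + L2_inner \<Omega> g h"
  by (simp add: L2_inner_def inner_add_left L2_inner_integrable)

lemma L2_inner_scaleR_left: "L2_inner \<Omega> (\<lambda>x. c *\<^sub>R f x) h = c * L2_inner \<Omega> f h"
  by (simp add: L2_inner_def)

lemma L2_inner_uminus_left: "L2_inner \<Omega> (\<lambda>x. - f x) h = - L2_inner \<Omega> f h"
  by (simp add: L2_inner_def)

lemma L2_inner_diff_left:
  "f \<in> L2 \<Omega> \<Longrightarrow> g \<in> L2 \<Omega> \<Longrightarrow> h \<in> L2 \<Omega> \<Longrightarrow>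
    L2_inner \<Omega> (\<lambda>x. f x - g x) h = L2_inner \<Omega> f h - L2_inner \<Omega> g h"
  by (simp add: L2_inner_def inner_diff_left L2_inner_integrable)

lemma L2_inner_diff_right:
  "f \<in> L2 \<Omega> \<Longrightarrow> g \<in> L2 \<Omega> \<Longrightarrow> h \<in> L2 \<Omega> \<Longrightarrow>
    L2_inner \<Omega> h (\<lambda>x. f x - g x) = L2_inner \<Omega> h f - L2_inner \<Omega> h g"
  by (simp add: L2_inner_def inner_diff_right L2_inner_integrable)

lemma L2_inner_zero_left: "L2_inner \<Omega> (\<lambda>x. 0) h = 0"
  by (simp add: L2_inner_def)

lemma L2_inner_sum_left:
  "(\<And>i. i \<in> I \<Longrightarrow> f i \<in> L2 \<Omega>) \<Longrightarrow> h \<in> L2 \<Omega> \<Longrightarrow>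
    L2_inner \<Omega> (\<lambda>x. \<Sum>i\<in>I. f i x) h = (\<Sum>i\<in>I. L2_inner \<Omega> (f i) h)"
  by (simp add: L2_inner_def inner_sum_left L2_inner_integrable)

lemma L2_inner_self_nonneg: "0 \<le> L2_inner \<Omega> f f"
  by (simp add: L2_inner_def)

lemma L2_norm_nonneg: "0 \<le> L2_norm \<Omega> f"
  by (simp add: L2_norm_def L2_inner_self_nonneg)

lemma L2_norm_sq: "(L2_norm \<Omega> f)\<^sup>2 = L2_inner \<Omega> f f"
  by (simp add: L2_norm_def L2_inner_self_nonneg)

lemma L2_inner_cong:
  assumes "L2_eq \<Omega> f f'" "f \<in> L2 \<Omega>" "f' \<in> L2 \<Omega>" "h \<in> L2 \<Omega>"
  shows "L2_inner \<Omega> f h = L2_inner \<Omega> f' h"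
  unfolding L2_inner_def
proof (rule integral_cong_AE)
  show "AE x in lebesgue_on \<Omega>. f x \<bullet> h x = f' x \<bullet> h x"
    using assms(1) unfolding L2_eq_def by eventually_elim simp
qed (use assms in \<open>auto simp: L2_def\<close>)

lemma L2_inner_self_eq_0_iff:
  assumes "f \<in> L2 \<Omega>"
  shows "L2_inner \<Omega> f f = 0 \<longleftrightarrow> L2_eq \<Omega> f (\<lambda>x. 0)"
  unfolding L2_inner_def L2_eq_def
  using integral_nonneg_eq_0_iff_AE[OF L2_inner_integrable[OF assms assms]] by simp

lemma L2_eq_refl: "L2_eq \<Omega> f f"
  by (simp add: L2_eq_def)

lemma L2_eq_sym: "L2_eq \<Omega> f g \<Longrightarrow> L2_eq \<Omega> g f"
  by (simp add: L2_eq_def eq_commute)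

lemma L2_eq_trans: "L2_eq \<Omega> f g \<Longrightarrow> L2_eq \<Omega> g h \<Longrightarrow> L2_eq \<Omega> f h"
  unfolding L2_eq_def by (rule AE_mp) auto

lemma L2_eq_diff_0: "L2_eq \<Omega> (\<lambda>x. f x - g x) (\<lambda>x. 0) \<longleftrightarrow> L2_eq \<Omega> f g"
  by (simp add: L2_eq_def)

lemma L2_eq_add: "L2_eq \<Omega> f f' \<Longrightarrow> L2_eq \<Omega> g g' \<Longrightarrow> L2_eq \<Omega> (\<lambda>x. f x + g x) (\<lambda>x. f' x + g' x)"
  unfolding L2_eq_def by (auto elim: AE_mp)

lemma L2_eq_scaleR: "L2_eq \<Omega> f f' \<Longrightarrow> L2_eq \<Omega> (\<lambda>x. c *\<^sub>R f x) (\<lambda>x. c *\<^sub>R f' x)"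
  unfolding L2_eq_def by (auto elim: AE_mp)

lemma L2_inner_Cauchy_Schwarz:
  assumes f: "f \<in> L2 \<Omega>" and g: "g \<in> L2 \<Omega>"
  shows "\<bar>L2_inner \<Omega> f g\<bar> \<le> L2_norm \<Omega> f * L2_norm \<Omega> g"
proof -
  define a b c where "a = L2_inner \<Omega> f f" "b = L2_inner \<Omega> f g" "c = L2_inner \<Omega> g g"
  have q: "0 \<le> a - 2 * t * b + t\<^sup>2 * c" for t
  proof -
    have "0 \<le> L2_inner \<Omega> (\<lambda>x. f x - t *\<^sub>R g x) (\<lambda>x. f x - t *\<^sub>R g x)"
      by (rule L2_inner_self_nonneg)
    also have "\<dots> = a - t * b - t * (b - t * c)"
      using f g by (simp add: L2_inner_diff_left L2_inner_diff_right L2_inner_scaleR_left L2_intros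
          L2_inner_commute[of \<Omega> _ "\<lambda>x. t *\<^sub>R g x"] a_b_c_def L2_inner_commute[of \<Omega> g f] algebra_simps)
    finally show ?thesis by (simp add: algebra_simps power2_eq_square)
  qed
  have ac: "0 \<le> a" "0 \<le> c" by (simp_all add: a_b_c_def L2_inner_self_nonneg)
  have "b\<^sup>2 \<le> a * c"
  proof (cases "c = 0")
    case True
    have "b = 0"
    proof (rule ccontr)
      assume "b \<noteq> 0"
      \<comment> \<open>For c = 0 the quadratic is affine in t; this t gives it the value -1. In the
        other case the minimiser b / c is inserted.\<close>
      with q[of "(a + 1) / (2 * b)"] True show False by (simp add: field_simps)
    qed
    then show ?thesis using True by simp
  next
    case False
    then have "c > 0" using ac by simp
    with q[of "b / c"] show ?thesis by (simp add: field_simps power2_eq_square)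
  qed
  then have "sqrt (b\<^sup>2) \<le> sqrt (a * c)" by (rule real_sqrt_le_mono)
  then show ?thesis by (simp add: L2_norm_def real_sqrt_mult a_b_c_def)
qed

lemma tendsto_L2_inner:
  assumes s: "\<And>n. s n \<in> L2 \<Omega>" and f: "f \<in> L2 \<Omega>" and h: "h \<in> L2 \<Omega>"
    and lim: "(\<lambda>n. L2_norm \<Omega> (\<lambda>x. s n x - f x)) \<longlonglongrightarrow> 0"
  shows "(\<lambda>n. L2_inner \<Omega> (s n) h) \<longlonglongrightarrow> L2_inner \<Omega> f h"
proof -
  have "(\<lambda>n. L2_inner \<Omega> (s n) h - L2_inner \<Omega> f h) \<longlonglongrightarrow> 0"
  proof (rule Lim_null_comparison)
    have "norm (L2_inner \<Omega> (s n) h - L2_inner \<Omega> f h)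
        \<le> L2_norm \<Omega> (\<lambda>x. s n x - f x) * L2_norm \<Omega> h" for n
      using L2_inner_Cauchy_Schwarz[OF L2_diff[OF s f] h] s f h by (simp add: L2_inner_diff_left)
    then show "\<forall>\<^sub>F n in sequentially. norm (L2_inner \<Omega> (s n) h - L2_inner \<Omega> f h)
        \<le> L2_norm \<Omega> (\<lambda>x. s n x - f x) * L2_norm \<Omega> h" by simp
    show "(\<lambda>n. L2_norm \<Omega> (\<lambda>x. s n x - f x) * L2_norm \<Omega> h) \<longlonglongrightarrow> 0"
      using tendsto_mult_right[OF lim] by simp
  qed
  then show ?thesis by (simp add: LIM_zero_iff)
qed

section \<open>Orthogonal complements and decompositions\<close>

lemma orth_compl_diff:
  "f \<in> orth_compl \<Omega> S \<Longrightarrow> g \<in> orth_compl \<Omega> S \<Longrightarrow> S \<subseteq> L2 \<Omega> \<Longrightarrow> (\<lambda>x. f x - g x) \<in> orth_compl \<Omega> S"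
  by (auto simp: orth_compl_def L2_diff L2_inner_diff_left subset_iff)

lemma orth_compl_scaleR:
  "f \<in> orth_compl \<Omega> S \<Longrightarrow> (\<lambda>x. c *\<^sub>R f x) \<in> orth_compl \<Omega> S"
  by (auto simp: orth_compl_def L2_scaleR L2_inner_scaleR_left)

lemma orth_compl_subset_L2: "orth_compl \<Omega> S \<subseteq> L2 \<Omega>"
  by (auto simp: orth_compl_def)

lemma subset_orth_compl_orth_compl: "S \<subseteq> L2 \<Omega> \<Longrightarrow> S \<subseteq> orth_compl \<Omega> (orth_compl \<Omega> S)"
  by (auto simp: orth_compl_def L2_inner_commute subset_iff)

lemma orth_compl_inter:
  assumes "f \<in> orth_compl \<Omega> S" "f \<in> orth_compl \<Omega> (orth_compl \<Omega> S)"
  shows "L2_eq \<Omega> f (\<lambda>x. 0)"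
proof -
  have "f \<in> L2 \<Omega>" "L2_inner \<Omega> f f = 0" using assms by (auto simp: orth_compl_def)
  then show ?thesis by (simp add: L2_inner_self_eq_0_iff)
qed

text \<open>Both \<open>a\<close> and \<open>p\<close> lie in the double complement, where
  differences may be formed. There \<open>a - p\<close> agrees almost everywhere with
  \<open>(f - p) - b\<close>, a member of the complement, so it is orthogonal to itself.\<close>

lemma orth_decomposition_unique:
  assumes S: "S \<subseteq> L2 \<Omega>"
    and a: "a \<in> S" and b: "b \<in> orth_compl \<Omega> S" and f: "L2_eq \<Omega> f (\<lambda>x. a x + b x)" "f \<in> L2 \<Omega>"
    and p: "is_orth_proj \<Omega> S f p" and r: "is_orth_proj \<Omega> (orth_compl \<Omega> S) f r"
  shows "L2_eq \<Omega> p a" "L2_eq \<Omega> r b"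
proof -
  let ?T = "orth_compl \<Omega> S"
  have T: "?T \<subseteq> L2 \<Omega>" by (rule orth_compl_subset_L2)
  have p': "p \<in> S" "(\<lambda>x. f x - p x) \<in> ?T" using p by (auto simp: is_orth_proj_def)
  have r': "r \<in> ?T" "(\<lambda>x. f x - r x) \<in> orth_compl \<Omega> ?T" using r by (auto simp: is_orth_proj_def)
  have aa: "a \<in> orth_compl \<Omega> ?T" "p \<in> orth_compl \<Omega> ?T"
    using a p'(1) subset_orth_compl_orth_compl[OF S] by auto
  have *: "L2_eq \<Omega> (\<lambda>x. (f x - p x) - b x) (\<lambda>x. a x - p x)"
    using f(1) unfolding L2_eq_def by (auto elim: AE_mp)
  have d: "(\<lambda>x. a x - p x) \<in> L2 \<Omega>" "(\<lambda>x. (f x - p x) - b x) \<in> L2 \<Omega>"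
    using a p'(1) S b T p'(2) by (auto intro!: L2_diff[of a] L2_diff[of "\<lambda>x. f x - p x"])
  have "L2_inner \<Omega> (\<lambda>x. a x - p x) (\<lambda>x. a x - p x) = L2_inner \<Omega> (\<lambda>x. (f x - p x) - b x) (\<lambda>x. a x - p x)"
    by (rule L2_inner_cong[OF L2_eq_sym[OF *]]) (use d in auto)
  also have "\<dots> = L2_inner \<Omega> (\<lambda>x. a x - p x) (\<lambda>x. (f x - p x) - b x)" by (rule L2_inner_commute)
  also have "\<dots> = 0"
    using orth_compl_diff[OF aa T] orth_compl_diff[OF p'(2) b S] by (auto simp: orth_compl_def)
  finally show pa: "L2_eq \<Omega> p a"
    using L2_eq_diff_0 L2_eq_sym d L2_inner_self_eq_0_iff by blast
  \<comment> \<open>The function p + r - f is written in two ways: one shows it in the complement,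
    the other in the double complement, so it vanishes almost everywhere.\<close>
  have e1: "(\<lambda>x. r x - (f x - p x)) \<in> ?T" by (rule orth_compl_diff[OF r'(1) p'(2) S])
  have "(\<lambda>x. p x - (f x - r x)) \<in> orth_compl \<Omega> ?T" by (rule orth_compl_diff[OF aa(2) r'(2) T])
  moreover have "(\<lambda>x. p x - (f x - r x)) = (\<lambda>x. r x - (f x - p x))" by auto
  ultimately have "L2_eq \<Omega> (\<lambda>x. r x - (f x - p x)) (\<lambda>x. 0)"
    using orth_compl_inter[OF e1] by simp
  then have "L2_eq \<Omega> r (\<lambda>x. f x - p x)" by (simp add: L2_eq_diff_0)
  moreover have "L2_eq \<Omega> (\<lambda>x. f x - p x) b"
    using f(1) pa unfolding L2_eq_def by eventually_elim simp
  ultimately show "L2_eq \<Omega> r b" by (rule L2_eq_trans)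
qed

subsection \<open>Completeness\<close>

text \<open>Integrate the pointwise bound |f| \<le> e + |f|^2 / e over a set of finite measure. The
  result is linear in \<open>e\<close>, so a Cauchy sequence in L2 is Cauchy in L1, where an almost
  everywhere convergent subsequence is available.\<close>

lemma L2_bound_L1:
  assumes om: "\<Omega> \<in> lmeasurable" and f: "f \<in> L2 \<Omega>" and e: "0 < e" and n: "L2_norm \<Omega> f \<le> e"
  shows "integrable (lebesgue_on \<Omega>) f"
    and "(\<integral>x. norm (f x) \<partial>lebesgue_on \<Omega>) \<le> e * (measure lebesgue \<Omega> + 1)"
proof -
  have fin: "integrable (lebesgue_on \<Omega>) (\<lambda>x. c)" for c :: real
    using om by (metis finite_measure.integrable_const finite_measure_lebesgue_on)
  have int: "integrable (lebesgue_on \<Omega>) (\<lambda>x. e + (f x \<bullet> f x) / e)"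
    using fin L2_inner_integrable[OF f f] by simp
  have bd: "norm (f x) \<le> e + (f x \<bullet> f x) / e" for x
  proof -
    have "0 \<le> norm (f x) * e" using e by simp
    with sum_squares_bound[of "norm (f x)" e] have "norm (f x) * e \<le> e * e + (norm (f x))\<^sup>2"
      unfolding power2_eq_square[of e] by linarith
    then show ?thesis using e by (simp add: field_simps power2_norm_eq_inner)
  qed
  have nn: "0 \<le> e + (f x \<bullet> f x) / e" for x using e by simp
  show i: "integrable (lebesgue_on \<Omega>) f"
    by (rule Bochner_Integration.integrable_bound[OF int L2_measurable[OF f]])
       (use bd nn in \<open>simp add: abs_of_nonneg\<close>)
  have "(\<integral>x. norm (f x) \<partial>lebesgue_on \<Omega>) \<le> (\<integral>x. e + (f x \<bullet> f x) / e \<partial>lebesgue_on \<Omega>)"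
    using i int bd by (intro integral_mono) auto
  also have "\<dots> = e * measure lebesgue \<Omega> + L2_inner \<Omega> f f / e"
    using fin L2_inner_integrable[OF f f] om
    by (simp add: L2_inner_def measure_restrict_space fmeasurableD)
  also have "L2_inner \<Omega> f f / e \<le> e"
    using n e L2_norm_nonneg[of \<Omega> f] L2_norm_sq[of \<Omega> f]
    by (simp add: divide_le_eq) (metis power_mono power2_eq_square)
  finally show "(\<integral>x. norm (f x) \<partial>lebesgue_on \<Omega>) \<le> e * (measure lebesgue \<Omega> + 1)"
    by (simp add: algebra_simps)
qed

text \<open>A subsequence converges almost everywhere because the sequence is Cauchy in L1. Fatou's
  lemma carries the L2 Cauchy bounds over to the distance from its pointwise limit, for the full
  sequence.\<close>

lemma L2_complete:
  fixes s :: "nat \<Rightarrow> real^3 \<Rightarrow> 'a::euclidean_space"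
  assumes om: "\<Omega> \<in> lmeasurable" and s: "\<And>n. s n \<in> L2 \<Omega>"
    and cauchy: "\<And>e. e > 0 \<Longrightarrow> \<exists>N. \<forall>i\<ge>N. \<forall>j\<ge>N. L2_norm \<Omega> (\<lambda>x. s i x - s j x) \<le> e"
  shows "\<exists>g\<in>L2 \<Omega>. (\<lambda>n. L2_norm \<Omega> (\<lambda>x. s n x - g x)) \<longlonglongrightarrow> 0"
proof -
  let ?M = "lebesgue_on \<Omega>"
  have si: "integrable ?M (s n)" for n
    using L2_bound_L1(1)[OF om s, of "max 1 (L2_norm \<Omega> (s n))" n] by simp
  have "\<exists>N. \<forall>i\<ge>N. \<forall>j\<ge>N. (LINT x|?M. norm (s i x - s j x)) < e" if "e > 0" for e
  proof -
    define d where "d = e / (measure lebesgue \<Omega> + 2)"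
    have pos: "measure lebesgue \<Omega> + 2 > 0" by (simp add: add_nonneg_pos)
    have d: "d > 0" using that pos by (simp add: d_def)
    have "d * (measure lebesgue \<Omega> + 1) < d * (measure lebesgue \<Omega> + 2)" using d by simp
    also have "\<dots> = e" using pos by (simp add: d_def)
    finally have de: "d * (measure lebesgue \<Omega> + 1) < e" .
    obtain N where "\<forall>i\<ge>N. \<forall>j\<ge>N. L2_norm \<Omega> (\<lambda>x. s i x - s j x) \<le> d" using cauchy d by blast
    then show ?thesis
      using L2_bound_L1(2)[OF om L2_diff[OF s s] d] de by (meson le_less_trans)
  qed
  then obtain r where r: "strict_mono r" "AE x in ?M. Cauchy (\<lambda>i. s (r i) x)"
    using cauchy_L1_AE_cauchy_subseq[of ?M s] si by blast
  define g where "g = (\<lambda>x. lim (\<lambda>i. s (r i) x))"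
  have sm [measurable]: "s n \<in> borel_measurable ?M" for n using s by (simp add: L2_def)
  have gm [measurable]: "g \<in> borel_measurable ?M"
    unfolding g_def by (rule borel_measurable_lim_metric) simp
  have lim: "AE x in ?M. (\<lambda>i. s (r i) x) \<longlonglongrightarrow> g x"
    using r(2) by eventually_elim (simp add: g_def Cauchy_convergent_iff convergent_LIMSEQ_iff)
  have fatou: "(\<integral>\<^sup>+x. ennreal ((norm (s n x - g x))\<^sup>2) \<partial>?M) \<le> ennreal (e\<^sup>2)"
    if N: "\<forall>i\<ge>N. \<forall>j\<ge>N. L2_norm \<Omega> (\<lambda>x. s i x - s j x) \<le> e" "n \<ge> N" for n N e
  proof -
    have "(\<integral>\<^sup>+x. ennreal ((norm (s n x - g x))\<^sup>2) \<partial>?M)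
        = (\<integral>\<^sup>+x. liminf (\<lambda>i. ennreal ((norm (s n x - s (r i) x))\<^sup>2)) \<partial>?M)"
    proof (rule nn_integral_cong_AE)
      show "AE x in ?M. ennreal ((norm (s n x - g x))\<^sup>2) = liminf (\<lambda>i. ennreal ((norm (s n x - s (r i) x))\<^sup>2))"
        using lim
      proof eventually_elim
        case (elim x)
        have "(\<lambda>i. ennreal ((norm (s n x - s (r i) x))\<^sup>2)) \<longlonglongrightarrow> ennreal ((norm (s n x - g x))\<^sup>2)"
          by (intro tendsto_ennrealI tendsto_power tendsto_norm tendsto_diff tendsto_const elim)
        then show ?case using lim_imp_Liminf[OF sequentially_bot] by metis
      qed
    qed
    also have "\<dots> \<le> liminf (\<lambda>i. \<integral>\<^sup>+x. ennreal ((norm (s n x - s (r i) x))\<^sup>2) \<partial>?M)"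
      by (rule nn_integral_liminf) measurable
    also have "\<dots> \<le> liminf (\<lambda>i. ennreal (e\<^sup>2))"
    proof (rule Liminf_mono)
      show "\<forall>\<^sub>F i in sequentially. (\<integral>\<^sup>+x. ennreal ((norm (s n x - s (r i) x))\<^sup>2) \<partial>?M) \<le> ennreal (e\<^sup>2)"
        unfolding eventually_sequentially
      proof (intro exI allI impI)
        fix i assume "N \<le> i"
        \<comment> \<open>A strictly increasing \<open>r\<close> satisfies r i \<ge> i, so the
          Cauchy bound applies along the subsequence from the same index on.\<close>
        then have "N \<le> r i" using seq_suble[OF r(1), of i] by simp
        then have "L2_norm \<Omega> (\<lambda>x. s n x - s (r i) x) \<le> e" using N by blast
        then have "L2_inner \<Omega> (\<lambda>x. s n x - s (r i) x) (\<lambda>x. s n x - s (r i) x) \<le> e\<^sup>2"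
          by (metis L2_norm_sq L2_norm_nonneg power_mono)
        moreover have "integrable ?M (\<lambda>x. (norm (s n x - s (r i) x))\<^sup>2)"
          using L2_diff[OF s s] by (auto simp: L2_def)
        ultimately show "(\<integral>\<^sup>+x. ennreal ((norm (s n x - s (r i) x))\<^sup>2) \<partial>?M) \<le> ennreal (e\<^sup>2)"
          by (subst nn_integral_eq_integral) (auto simp: L2_inner_def power2_norm_eq_inner ennreal_leI)
      qed
    qed
    also have "\<dots> = ennreal (e\<^sup>2)" by (simp add: Liminf_const)
    finally show ?thesis .
  qed
  have dL2: "(\<lambda>x. s n x - g x) \<in> L2 \<Omega>"
    and dnorm: "0 \<le> e \<Longrightarrow> L2_norm \<Omega> (\<lambda>x. s n x - g x) \<le> e"
    if N: "\<forall>i\<ge>N. \<forall>j\<ge>N. L2_norm \<Omega> (\<lambda>x. s i x - s j x) \<le> e" "n \<ge> N" for n N e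
  proof -
    have int: "integrable ?M (\<lambda>x. (norm (s n x - g x))\<^sup>2)"
      using fatou[OF N] by (intro integrableI_bounded) (auto simp: less_top[symmetric] top_unique)
    then show "(\<lambda>x. s n x - g x) \<in> L2 \<Omega>" by (simp add: L2_def)
    assume e: "0 \<le> e"
    have "ennreal (L2_inner \<Omega> (\<lambda>x. s n x - g x) (\<lambda>x. s n x - g x)) \<le> ennreal (e\<^sup>2)"
      using fatou[OF N] int
      by (subst (asm) nn_integral_eq_integral) (auto simp: L2_inner_def power2_norm_eq_inner)
    then have "L2_inner \<Omega> (\<lambda>x. s n x - g x) (\<lambda>x. s n x - g x) \<le> e\<^sup>2" by simp
    then show "L2_norm \<Omega> (\<lambda>x. s n x - g x) \<le> e"
      using e by (simp add: L2_norm_def real_le_lsqrt L2_inner_self_nonneg)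
  qed
  obtain N where "\<forall>i\<ge>N. \<forall>j\<ge>N. L2_norm \<Omega> (\<lambda>x. s i x - s j x) \<le> 1" using cauchy[of 1] by auto
  \<comment> \<open>Membership of \<open>g\<close> is read off from g = s N - (s N - g).\<close>
  from L2_diff[OF s[of N] dL2[OF this order_refl]] have "g \<in> L2 \<Omega>" by simp
  moreover have "(\<lambda>n. L2_norm \<Omega> (\<lambda>x. s n x - g x)) \<longlonglongrightarrow> 0"
  proof (rule LIMSEQ_I)
    fix e :: real assume e: "e > 0"
    obtain N where N: "\<forall>i\<ge>N. \<forall>j\<ge>N. L2_norm \<Omega> (\<lambda>x. s i x - s j x) \<le> e / 2" using cauchy[of "e/2"] e by auto
    have "norm (L2_norm \<Omega> (\<lambda>x. s n x - g x) - 0) < e" if "n \<ge> N" for n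
      using dnorm[OF N that] e L2_norm_nonneg[of \<Omega> "\<lambda>x. s n x - g x"] by simp
    then show "\<exists>no. \<forall>n\<ge>no. norm (L2_norm \<Omega> (\<lambda>x. s n x - g x) - 0) < e"
      by blast
  qed
  ultimately show ?thesis by blast
qed

section \<open>Calculus of continuously differentiable functions\<close>

lemma pd_eq: "(f has_derivative D) (at x) \<Longrightarrow> pd i f x = D (axis i 1)"
  unfolding pd_def using frechet_derivative_at by metis

lemma pd_const [simp]: "pd i (\<lambda>x. c) = (\<lambda>x. 0)"
  by (simp add: pd_def fun_eq_iff)

lemma pd_bounded_linear:
  assumes "bounded_linear L" "f differentiable at x"
  shows "pd i (\<lambda>x. L (f x)) x = L (pd i f x)"
proof -
  have "((\<lambda>x. L (f x)) has_derivative (\<lambda>h. L (frechet_derivative f (at x) h))) (at x)"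
    using bounded_linear.has_derivative[OF assms(1)] assms(2) frechet_derivative_works by blast
  from pd_eq[OF this] show ?thesis by (simp add: pd_def)
qed

lemma pd_add:
  assumes "f differentiable at x" "g differentiable at x"
  shows "pd i (\<lambda>x. f x + g x) x = pd i f x + pd i g x"
proof -
  have "((\<lambda>x. f x + g x) has_derivative
      (\<lambda>h. frechet_derivative f (at x) h + frechet_derivative g (at x) h)) (at x)"
    using assms by (intro has_derivative_add) (simp_all add: frechet_derivative_works[symmetric])
  from pd_eq[OF this] show ?thesis by (simp add: pd_def)
qed

lemma pd_bounded_bilinear:
  assumes "bounded_bilinear B" "f differentiable at x" "g differentiable at x"
  shows "pd i (\<lambda>x. B (f x) (g x)) x = B (f x) (pd i g x) + B (pd i f x) (g x)"
proof -
  have "((\<lambda>x. B (f x) (g x)) has_derivative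
      (\<lambda>h. B (f x) (frechet_derivative g (at x) h) + B (frechet_derivative f (at x) h) (g x))) (at x)"
    using assms(2,3) by (intro bounded_bilinear.FDERIV[OF assms(1)]) (simp_all add: frechet_derivative_works[symmetric])
  from pd_eq[OF this] show ?thesis by (simp add: pd_def)
qed

lemma bounded_bilinear_differentiable:
  assumes "bounded_bilinear B" "f differentiable at x" "g differentiable at x"
  shows "(\<lambda>x. B (f x) (g x)) differentiable at x"
  using bounded_bilinear.FDERIV[OF assms(1)] assms(2,3) unfolding differentiable_def by blast

lemma bounded_linear_differentiable:
  assumes "bounded_linear L" "f differentiable at x"
  shows "(\<lambda>x. L (f x)) differentiable at x"
  using bounded_linear.has_derivative[OF assms(1)] assms(2) unfolding differentiable_def by blast

lemma pd_cong_open: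
  assumes "f differentiable at x" "open U" "x \<in> U" "\<And>y. y \<in> U \<Longrightarrow> f y = g y"
  shows "g differentiable at x" "pd i g x = pd i f x"
proof -
  have "(g has_derivative frechet_derivative f (at x)) (at x)"
    using has_derivative_transform_within_open[of f _ x UNIV U g] assms
    by (simp add: frechet_derivative_works)
  then show "g differentiable at x" "pd i g x = pd i f x"
    using pd_eq[of g _ x i] by (auto simp: differentiable_def pd_def)
qed

text \<open>Derivative formulas such as the product rule hold only at the points of
  \<open>U\<close>, not as equations between functions on the whole space. This transfer lets the
  closure properties below proceed by induction on \<open>k\<close>.\<close>

lemma Ck_on_cong:
  assumes "open U"
  shows "(\<And>x. x \<in> U \<Longrightarrow> f x = g x) \<Longrightarrow> Ck_on k U f \<Longrightarrow> Ck_on k U g"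
proof (induction k arbitrary: f g)
  case 0
  then show ?case using continuous_on_cong[OF refl, of U f g] by simp
next
  case (Suc k)
  have d: "\<forall>x\<in>U. f differentiable at x" "Ck_on k U (pd i f)" for i using Suc.prems(2) by auto
  have "g differentiable at x" "pd i f x = pd i g x" if "x \<in> U" for x i
    using pd_cong_open(1)[of f x U g] pd_cong_open(2)[of f x U g i] that d(1) assms Suc.prems(1) by auto
  then show ?case using Suc.IH[OF _ d(2)] by simp
qed

lemma Ck_on_subset: "Ck_on k U f \<Longrightarrow> V \<subseteq> U \<Longrightarrow> Ck_on k V f"
  by (induction k arbitrary: f) (auto intro: continuous_on_subset)

lemma Ck_on_SucD: "Ck_on (Suc k) U f \<Longrightarrow> Ck_on k U f"
proof (induction k arbitrary: f)
  case 0
  then show ?case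
    by (auto intro!: continuous_at_imp_continuous_on differentiable_imp_continuous_within)
next
  case (Suc k)
  then show ?case by (metis Ck_on.simps(2))
qed

lemma Ck_on_le: "Ck_on l U f \<Longrightarrow> k \<le> l \<Longrightarrow> Ck_on k U f"
proof (induction l)
  case (Suc l)
  then show ?case using Ck_on_SucD[OF Suc.prems(1)] by (cases "k = Suc l") auto
qed simp

lemma Ck_on_imp_continuous: "Ck_on k U f \<Longrightarrow> continuous_on U f"
  using Ck_on_le[of k U f 0] by simp

lemma Ck_on_const: "Ck_on k U (\<lambda>x. c)"
  by (induction k arbitrary: c) auto

lemma Ck_on_bounded_linear:
  assumes "open U" and L: "bounded_linear L"
  shows "Ck_on k U f \<Longrightarrow> Ck_on k U (\<lambda>x. L (f x))"
proof (induction k arbitrary: f)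
  case 0
  then show ?case by (simp add: bounded_linear.continuous_on[OF L])
next
  case (Suc k)
  then have "Ck_on k U (\<lambda>x. L (pd i f x))" "\<forall>x\<in>U. f differentiable at x" for i by auto
  then show ?case
    using Ck_on_cong[OF assms(1), of "\<lambda>x. L (pd i f x)" "pd i (\<lambda>x. L (f x))" k for i]
    by (auto simp: pd_bounded_linear[OF L] bounded_linear_differentiable[OF L])
qed

lemma Ck_on_add:
  assumes "open U"
  shows "Ck_on k U f \<Longrightarrow> Ck_on k U g \<Longrightarrow> Ck_on k U (\<lambda>x. f x + g x)"
proof (induction k arbitrary: f g)
  case 0
  then show ?case by (simp add: continuous_on_add)
next
  case (Suc k)
  then have "Ck_on k U (\<lambda>x. pd i f x + pd i g x)"
    "\<forall>x\<in>U. f differentiable at x" "\<forall>x\<in>U. g differentiable at x" for i by auto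
  then show ?case
    using Ck_on_cong[OF assms(1), of "\<lambda>x. pd i f x + pd i g x" "pd i (\<lambda>x. f x + g x)" k for i]
    by (auto simp: pd_add)
qed

lemma Ck_on_bounded_bilinear:
  assumes U: "open U" and B: "bounded_bilinear B"
  shows "Ck_on k U f \<Longrightarrow> Ck_on k U g \<Longrightarrow> Ck_on k U (\<lambda>x. B (f x) (g x))"
proof (induction k arbitrary: f g)
  case 0
  then show ?case by (simp add: bounded_bilinear.continuous_on[OF B])
next
  case (Suc k)
  have d: "\<forall>x\<in>U. f differentiable at x" "\<forall>x\<in>U. g differentiable at x" using Suc.prems by auto
  have "Ck_on k U (\<lambda>x. B (f x) (pd i g x) + B (pd i f x) (g x))" for i
    using Suc.prems Ck_on_SucD[OF Suc.prems(1)] Ck_on_SucD[OF Suc.prems(2)]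
    by (intro Ck_on_add[OF U] Suc.IH) auto
  then show ?case
    using d Ck_on_cong[OF U, of "\<lambda>x. B (f x) (pd i g x) + B (pd i f x) (g x)" "pd i (\<lambda>x. B (f x) (g x))" k for i]
    by (auto simp: pd_bounded_bilinear[OF B] bounded_bilinear_differentiable[OF B])
qed

lemmas Ck_on_mult = Ck_on_bounded_bilinear[OF _ bounded_bilinear_mult]
lemmas pd_mult = pd_bounded_bilinear[OF bounded_bilinear_mult]
lemmas pd_cmult = pd_bounded_linear[OF bounded_linear_mult_right]

lemma Ck_on_sum:
  assumes "open U"
  shows "(\<And>i. i \<in> I \<Longrightarrow> Ck_on k U (f i)) \<Longrightarrow> Ck_on k U (\<lambda>x. \<Sum>i\<in>I. f i x)"
  by (induction I rule: infinite_finite_induct) (auto intro: Ck_on_const Ck_on_add[OF assms])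

lemma pd_sum:
  assumes "\<And>j. j \<in> I \<Longrightarrow> f j differentiable at x"
  shows "pd i (\<lambda>x. \<Sum>j\<in>I. f j x) x = (\<Sum>j\<in>I. pd i (f j) x)"
  using assms
  by (induction I rule: infinite_finite_induct) (simp_all add: pd_add)

lemma component_differentiable: "(\<lambda>x::real^3. x $ i) differentiable at x"
  by (rule bounded_linear_imp_differentiable) (rule bounded_linear_vec_nth)

lemma pd_component: "pd i (\<lambda>x. x $ j) x = (if i = j then 1 else 0)"
  using pd_eq[OF bounded_linear_imp_has_derivative[OF bounded_linear_vec_nth[of j]], of i x]
  by (auto simp: axis_def)

lemma Ck_on_component: "Ck_on k U (\<lambda>x::real^3. x $ j)"
proof (cases k)
  case 0
  then show ?thesis by (auto intro: continuous_intros)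
next
  case (Suc l)
  have "pd i (\<lambda>x::real^3. x $ j) = (\<lambda>x. if i = j then 1 else 0)" for i by (auto simp: pd_component)
  then show ?thesis using Suc by (simp add: Ck_on_const component_differentiable)
qed

subsection \<open>Truncated powers\<close>

text \<open>An exponent of at least two removes the corner of \<open>max 0 t\<close> at the
  origin.\<close>

lemma DERIV_max_power:
  "((\<lambda>t::real. max 0 t ^ Suc (Suc n)) has_real_derivative real (Suc (Suc n)) * max 0 t ^ Suc n) (at t)"
proof -
  consider "t > 0" | "t < 0" | "t = 0" by linarith
  then show ?thesis
  proof cases
    case 1
    have "((\<lambda>t::real. t ^ Suc (Suc n)) has_real_derivative real (Suc (Suc n)) * t ^ Suc n) (at t)"
      by (rule DERIV_pow[THEN DERIV_cong]) simp
    then have "((\<lambda>t::real. max 0 t ^ Suc (Suc n)) has_real_derivative real (Suc (Suc n)) * t ^ Suc n) (at t)"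
      by (rule has_field_derivative_transform_within_open[where S="{0<..}"]) (use 1 in auto)
    then show ?thesis using 1 by simp
  next
    case 2
    have "((\<lambda>t::real. max 0 t ^ Suc (Suc n)) has_real_derivative 0) (at t)"
      by (rule has_field_derivative_transform_within_open[OF DERIV_const, where S="{..<0}"]) (use 2 in auto)
    then show ?thesis using 2 by simp
  next
    case 3
    have "isCont (\<lambda>z::real. max 0 z ^ Suc n) 0" by (intro continuous_intros)
    \<comment> \<open>Both sides vanish for negative z, so \<open>max 0 z ^ Suc n\<close> is a
      continuous slope function at 0, as Caratheodory's criterion asks.\<close>
    moreover have "max 0 z ^ Suc (Suc n) = max 0 z ^ Suc n * z" for z :: real by (simp add: max_def)
    ultimately show ?thesis
      using 3 by (simp only: CARAT_DERIV) (intro exI[of _ "\<lambda>z. max 0 z ^ Suc n"], auto)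
  qed
qed

lemma max_power_has_derivative:
  assumes "p differentiable at x"
  shows "(\<lambda>x. max 0 (p x :: real) ^ Suc (Suc n)) differentiable at x"
    and "pd i (\<lambda>x. max 0 (p x) ^ Suc (Suc n)) x = real (Suc (Suc n)) * max 0 (p x) ^ Suc n * pd i p x"
proof -
  have "((\<lambda>x. max 0 (p x) ^ Suc (Suc n)) has_derivative
    (\<lambda>h. frechet_derivative p (at x) h * (real (Suc (Suc n)) * max 0 (p x) ^ Suc n))) (at x)"
    using DERIV_compose_FDERIV[OF DERIV_max_power] assms by (simp add: frechet_derivative_works)
  from pd_eq[OF this] this
  show "(\<lambda>x. max 0 (p x) ^ Suc (Suc n)) differentiable at x"
    "pd i (\<lambda>x. max 0 (p x) ^ Suc (Suc n)) x = real (Suc (Suc n)) * max 0 (p x) ^ Suc n * pd i p x"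
    by (auto simp: differentiable_def pd_def)
qed

text \<open>Each derivative lowers the exponent by one, down to the first power, which is just
  continuous.\<close>

lemma Ck_on_max_power:
  fixes p :: "real^3 \<Rightarrow> real"
  assumes "open U" and p: "\<And>k. Ck_on k U p"
  shows "Ck_on n U (\<lambda>x. max 0 (p x) ^ Suc n)"
proof (induction n)
  case 0
  then show ?case using p[of 0] by (auto intro!: continuous_intros)
next
  case (Suc n)
  have d: "\<forall>x\<in>U. p differentiable at x" using p[of 1] by simp
  have "Ck_on n U (\<lambda>x. real (Suc (Suc n)) * max 0 (p x) ^ Suc n * pd i p x)" for i
    using p[of "Suc n"] by (intro Ck_on_mult Ck_on_const assms(1) Suc) simp
  then have "Ck_on n U (pd i (\<lambda>x. max 0 (p x) ^ Suc (Suc n)))" for i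
    by (rule Ck_on_cong[OF assms(1), rotated]) (use d in \<open>simp only: max_power_has_derivative\<close>)
  then show ?case
    unfolding Ck_on.simps using d max_power_has_derivative(1) by blast
qed

section \<open>Compactly supported functions of finite smoothness\<close>

definition paraboloid :: "real^3 \<Rightarrow> real \<Rightarrow> real^3 \<Rightarrow> real" where
  "paraboloid c r x = r\<^sup>2 - (\<Sum>j\<in>UNIV. (x $ j - c $ j) * (x $ j - c $ j))"

lemma paraboloid_eq: "paraboloid c r x = r\<^sup>2 - (norm (x - c))\<^sup>2"
  by (simp add: paraboloid_def power2_norm_eq_inner inner_vec_def)

lemma Ck_on_coordinate_diff: "Ck_on k UNIV (\<lambda>x::real^3. x $ j - a)"
  using Ck_on_add[OF open_UNIV Ck_on_component[of k UNIV j] Ck_on_const[of k UNIV "- a"]] by simp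

lemma coordinate_diff_differentiable: "(\<lambda>x::real^3. x $ j - a) differentiable at x"
  by (intro differentiable_diff component_differentiable differentiable_const)

lemma pd_coordinate_diff: "pd i (\<lambda>x. x $ j - a) x = (if i = j then 1 else 0)"
  using pd_add[OF component_differentiable differentiable_const, of i j "-a" x]
  by (simp add: pd_component)

lemma Ck_on_paraboloid: "Ck_on k UNIV (paraboloid c r)"
proof -
  \<comment> \<open>The difference is rewritten with a factor -1, so that only the rules for sums
    and products are involved.\<close>
  have "Ck_on k UNIV (\<lambda>x. r\<^sup>2 + (-1) * (\<Sum>j\<in>UNIV. (x $ j - c $ j) * (x $ j - c $ j)))"
    by (intro Ck_on_add Ck_on_mult Ck_on_sum Ck_on_const Ck_on_coordinate_diff open_UNIV)
  then show ?thesis by (simp add: paraboloid_def[abs_def])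
qed

lemma pd_paraboloid: "pd i (paraboloid c r) x = - 2 * (x $ i - c $ i)"
proof -
  have d: "(\<lambda>x. (x $ j - c $ j) * (x $ j - c $ j)) differentiable at x" for j
    by (intro differentiable_mult coordinate_diff_differentiable)
  have "pd i (\<lambda>x. r\<^sup>2 + (-1) * (\<Sum>j\<in>UNIV. (x $ j - c $ j) * (x $ j - c $ j))) x
      = pd i (\<lambda>x. r\<^sup>2) x + (-1) * (\<Sum>j\<in>UNIV. pd i (\<lambda>x. (x $ j - c $ j) * (x $ j - c $ j)) x)"
    using d by (simp only: pd_add pd_cmult pd_sum differentiable_mult differentiable_sum differentiable_const
        finite ball_simps simp_thms)
  also have "\<dots> = - 2 * (x $ i - c $ i)"
    by (simp add: pd_mult coordinate_diff_differentiable pd_coordinate_diff if_distrib[of "\<lambda>t. _ * t"]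
        if_distrib[of "\<lambda>t. t * _"] sum.distrib cong: if_cong)
  finally show ?thesis by (simp add: paraboloid_def[abs_def])
qed

text \<open>The exponent is \<open>Suc n\<close> so that the index \<open>n\<close> is the order of
  differentiability. For r \<ge> 0 the function is positive on the open ball and zero elsewhere; it
  serves with n = 2 and n = 3.\<close>

definition bump :: "real^3 \<Rightarrow> real \<Rightarrow> nat \<Rightarrow> real^3 \<Rightarrow> real" where
  "bump c r n x = max 0 (paraboloid c r x) ^ Suc n"

lemma Ck_on_bump: "Ck_on n UNIV (bump c r n)"
  unfolding bump_def[abs_def] by (rule Ck_on_max_power[OF open_UNIV Ck_on_paraboloid])

lemma bump_outside: "0 \<le> r \<Longrightarrow> x \<notin> ball c r \<Longrightarrow> bump c r n x = 0"
  by (simp add: bump_def paraboloid_eq dist_norm norm_minus_commute)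

lemma bump_pos: "x \<in> ball c r \<Longrightarrow> 0 < bump c r n x"
  unfolding bump_def paraboloid_eq
  by (rule zero_less_power) (auto simp: dist_norm norm_minus_commute less_max_iff_disj intro: power_strict_mono)

lemma pd_bump: "pd i (bump c r (Suc n)) x = - 2 * real (Suc (Suc n)) * (x $ i - c $ i) * bump c r n x"
proof -
  have "paraboloid c r differentiable at x" using Ck_on_paraboloid[of 1 c r] by simp
  from max_power_has_derivative(2)[OF this, of i n] show ?thesis
    unfolding bump_def[abs_def] by (simp only: pd_paraboloid) (simp only: mult_ac mult_minus_left mult_minus_right)
qed

section \<open>Integration by parts\<close>

lemma integrable_continuous_compact_support:
  fixes u :: "real^3 \<Rightarrow> 'a::{banach, second_countable_topology}"
  assumes "compact K" "continuous_on UNIV u" "\<And>x. x \<notin> K \<Longrightarrow> u x = 0"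
  shows "integrable lborel u"
proof -
  have "u = (\<lambda>x. indicator K x *\<^sub>R u x)" using assms(3) by (auto simp: indicator_def fun_eq_iff)
  then show ?thesis
    using borel_integrable_compact[OF assms(1) continuous_on_subset[OF assms(2)]] by simp
qed

lemma pd_outside_compact:
  assumes "compact K" "\<And>x. x \<notin> K \<Longrightarrow> u x = 0" "x \<notin> K"
  shows "u differentiable at x" "pd i u x = 0"
  using pd_cong_open(1)[of "\<lambda>x. 0" x "- K" u] pd_cong_open(2)[of "\<lambda>x. 0" x "- K" u i] assms
  by (auto simp: compact_imp_closed open_Compl)

text \<open>The difference quotients of \<open>u\<close> have integral zero by translation invariance.\<close>
lemma integral_pd_compact_support:
  fixes u :: "real^3 \<Rightarrow> real"
  assumes diff: "\<And>x. u differentiable at x" and cont: "continuous_on UNIV (pd i u)"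
    and K: "compact K" and out: "\<And>x. x \<notin> K \<Longrightarrow> u x = 0"
  shows "integral\<^sup>L lborel (pd i u) = 0"
proof -
  define e :: "real^3" where "e = axis i 1"
  have e: "norm e = 1" by (simp add: e_def norm_axis_1)
  have line: "((\<lambda>t. u (x + t *\<^sub>R e)) has_real_derivative pd i u (x + t *\<^sub>R e)) (at t)" for x t
  proof -
    let ?D = "frechet_derivative u (at (x + t *\<^sub>R e))"
    have D: "(u has_derivative ?D) (at (x + t *\<^sub>R e))" using diff by (simp add: frechet_derivative_works[symmetric])
    have "((\<lambda>t. x + t *\<^sub>R e) has_derivative (\<lambda>h. h *\<^sub>R e)) (at t)"
      by (auto intro!: derivative_eq_intros)
    from has_derivative_compose[OF this D]
    have "((\<lambda>t. u (x + t *\<^sub>R e)) has_derivative (\<lambda>h. ?D (h *\<^sub>R e))) (at t)" .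
    moreover have "(\<lambda>h. ?D (h *\<^sub>R e)) = (*) (pd i u (x + t *\<^sub>R e))"
      using linear_cmul[OF has_derivative_linear[OF D]] by (auto simp: pd_def e_def)
    ultimately show ?thesis by (simp add: has_field_derivative_def)
  qed
  obtain B where B: "\<And>x. x \<in> K \<Longrightarrow> \<bar>pd i u x\<bar> \<le> B"
    using compact_imp_bounded[OF compact_continuous_image[OF continuous_on_subset[OF cont] K]]
    by (auto simp: bounded_iff)
  \<comment> \<open>The absolute value matters for empty \<open>K\<close>, where \<open>B\<close>
    may be negative.\<close>
  have B': "\<bar>pd i u x\<bar> \<le> \<bar>B\<bar>" for x
    using B[of x] pd_outside_compact(2)[OF K, of u x i] out by (cases "x \<in> K") auto
  obtain R where R: "\<And>x. x \<in> K \<Longrightarrow> norm x \<le> R" using compact_imp_bounded[OF K] by (auto simp: bounded_iff)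
  have cu: "continuous_on UNIV u"
    using diff by (auto intro!: continuous_at_imp_continuous_on differentiable_imp_continuous_within)
  \<comment> \<open>Steps of length at most 1 keep the supports of all difference quotients within
    radius R + 1, which gives one dominating function.\<close>
  define h where "h n = 1 / real (Suc n)" for n
  have h: "0 < h n" "h n \<le> 1" for n by (simp_all add: h_def field_simps)
  define D where "D n x = (u (x + h n *\<^sub>R e) - u x) / h n" for n x
  have "(\<lambda>n. integral\<^sup>L lborel (D n)) \<longlonglongrightarrow> integral\<^sup>L lborel (pd i u)"
  proof (rule integral_dominated_convergence[where w="\<lambda>x. indicator (cball 0 (R + 1)) x *\<^sub>R \<bar>B\<bar>"])
    show "pd i u \<in> borel_measurable lborel"
      using borel_measurable_continuous_onI[OF cont] by simp
    have "continuous_on UNIV (D n)" for n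
      unfolding D_def using h(1)[of n] by (intro continuous_intros continuous_on_compose2[OF cu]) auto
    then show "D n \<in> borel_measurable lborel" for n
      by (simp add: borel_measurable_continuous_onI)
    show "integrable lborel (\<lambda>x::real^3. indicator (cball 0 (R + 1)) x *\<^sub>R \<bar>B\<bar>)"
      by (rule borel_integrable_compact) auto
    have hlim: "filterlim h (at 0) sequentially"
      unfolding filterlim_at using h(1) LIMSEQ_Suc[OF lim_1_over_n]
      by (auto simp: h_def[abs_def] less_imp_neq[symmetric])
    show "AE x in lborel. (\<lambda>n. D n x) \<longlonglongrightarrow> pd i u x"
    proof (rule AE_I2)
      fix x :: "real^3"
      have "((\<lambda>t. (u (x + t *\<^sub>R e) - u x) / t) \<longlongrightarrow> pd i u x) (at 0)"
        using line[of x 0] by (simp add: has_field_derivative_iff)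
      from filterlim_compose[OF this hlim] show "(\<lambda>n. D n x) \<longlonglongrightarrow> pd i u x"
        by (simp add: D_def)
    qed
    have "\<bar>D n x\<bar> \<le> indicator (cball 0 (R + 1)) x * \<bar>B\<bar>" for n x
    proof -
      \<comment> \<open>The mean value theorem turns the quotient into a value of the derivative, so
        the bound does not depend on \<open>n\<close>.\<close>
      obtain z where "u (x + h n *\<^sub>R e) - u (x + 0 *\<^sub>R e) = (h n - 0) * pd i u (x + z *\<^sub>R e)"
        using MVT2[OF h(1)[of n], of "\<lambda>t. u (x + t *\<^sub>R e)" "\<lambda>t. pd i u (x + t *\<^sub>R e)"] line by blast
      then have *: "D n x = pd i u (x + z *\<^sub>R e)" using h(1)[of n] by (simp add: D_def)
      show ?thesis
      proof (cases "norm x \<le> R + 1")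
        case True
        then show ?thesis using * B' by simp
      next
        case False
        have "norm x \<le> norm (x + h n *\<^sub>R e) + norm (h n *\<^sub>R e)" by (metis add_diff_cancel_right' norm_triangle_ineq4)
        then have "\<not> norm (x + h n *\<^sub>R e) \<le> R" using False h[of n] e by simp
        with False R have "x \<notin> K" "x + h n *\<^sub>R e \<notin> K" by fastforce+
        then show ?thesis using out by (simp add: D_def)
      qed
    qed
    then show "AE x in lborel. norm (D n x) \<le> indicator (cball 0 (R + 1)) x *\<^sub>R \<bar>B\<bar>" for n by simp
  qed
  moreover have "integral\<^sup>L lborel (D n) = 0" for n
  proof -
    have int: "integrable lborel u" by (rule integrable_continuous_compact_support[OF K cu out])
    have d: "distr lborel borel ((+) (h n *\<^sub>R e)) = lborel" by (rule lborel_distr_plus)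
    have um: "u \<in> borel_measurable borel" using borel_measurable_continuous_onI[OF cu] .
    have "integrable lborel (\<lambda>x. u (h n *\<^sub>R e + x))"
      using int integrable_distr_eq[of "(+) (h n *\<^sub>R e)" lborel borel u] um by (simp add: d)
    moreover have "(\<integral>x. u (h n *\<^sub>R e + x) \<partial>lborel) = integral\<^sup>L lborel u"
      using integral_distr[of "(+) (h n *\<^sub>R e)" lborel borel u] um by (simp add: d)
    ultimately show ?thesis using int by (simp add: D_def[abs_def] add.commute)
  qed
  ultimately show ?thesis by (simp add: LIMSEQ_const_iff)
qed

text \<open>Inner products are taken over \<open>lebesgue_on \<Omega>\<close>, while translation
  invariance was exploited over \<open>lborel\<close>. Since \<open>u\<close> is controlled only
  inside \<open>\<Omega>\<close>, it is cut off to zero outside before the two integrals are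
  compared.\<close>

lemma compact_support_lebesgue_on:
  fixes u :: "real^3 \<Rightarrow> real"
  assumes \<Omega>: "open \<Omega>" and K: "compact K" "K \<subseteq> \<Omega>" and u: "continuous_on \<Omega> u" "\<And>x. x \<in> \<Omega> \<Longrightarrow> x \<notin> K \<Longrightarrow> u x = 0"
  shows "integrable (lebesgue_on \<Omega>) u"
    and "integral\<^sup>L (lebesgue_on \<Omega>) u = integral\<^sup>L lborel (\<lambda>x. if x \<in> \<Omega> then u x else 0)"
proof -
  have *: "(\<lambda>x. indicator \<Omega> x *\<^sub>R u x) = (\<lambda>x. indicator K x *\<^sub>R u x)"
    using u(2) K(2) by (auto simp: indicator_def fun_eq_iff)
  have **: "(\<lambda>x. indicator K x *\<^sub>R u x) = (\<lambda>x. if x \<in> \<Omega> then u x else 0)"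
    unfolding *[symmetric] by (auto simp: indicator_def fun_eq_iff)
  have i: "integrable lborel (\<lambda>x. indicator K x *\<^sub>R u x)"
    by (rule borel_integrable_compact[OF K(1) continuous_on_subset[OF u(1) K(2)]])
  have o: "\<Omega> \<inter> space lebesgue \<in> sets lebesgue" using \<Omega> by auto
  show "integrable (lebesgue_on \<Omega>) u"
    unfolding integrable_restrict_space[OF o] * using i by (simp add: integrable_completion)
  show "integral\<^sup>L (lebesgue_on \<Omega>) u = integral\<^sup>L lborel (\<lambda>x. if x \<in> \<Omega> then u x else 0)"
    unfolding integral_restrict_space[OF o] *
    using i ** by (simp add: integral_completion)
qed

text \<open>The product \<phi> g, extended by zero, is differentiable on the whole space with
  continuous partial derivative in direction \<open>i\<close>, because \<phi> vanishes off a compact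
  part of \<open>\<Omega>\<close>. The integral of that derivative is zero, which is the claim by
  the product rule.\<close>

lemma integration_by_parts:
  fixes \<phi> g :: "real^3 \<Rightarrow> real"
  assumes \<Omega>: "open \<Omega>" and K: "compact K" "K \<subseteq> \<Omega>"
    and \<phi>: "Ck_on 1 UNIV \<phi>" "\<And>x. x \<notin> K \<Longrightarrow> \<phi> x = 0" and g: "Ck_on 1 \<Omega> g"
  shows "L2_inner \<Omega> (pd i \<phi>) g = - L2_inner \<Omega> \<phi> (pd i g)"
proof -
  define u where "u x = (if x \<in> \<Omega> then \<phi> x * g x else 0)" for x
  define v where "v x = (if x \<in> \<Omega> then \<phi> x * pd i g x + pd i \<phi> x * g x else 0)" for x
  have d\<phi>: "\<phi> differentiable at x" for x using \<phi>(1) by simp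
  have dg: "g differentiable at x" if "x \<in> \<Omega>" for x using g that by simp
  have c: "continuous_on UNIV \<phi>" "continuous_on UNIV (pd i \<phi>)" "continuous_on \<Omega> g" "continuous_on \<Omega> (pd i g)"
    using Ck_on_imp_continuous[OF \<phi>(1)] Ck_on_imp_continuous[OF g] \<phi>(1) g by auto
  have cp: "continuous_on \<Omega> (\<lambda>x. \<phi> x * pd i g x)" "continuous_on \<Omega> (\<lambda>x. pd i \<phi> x * g x)"
    by (intro continuous_on_mult continuous_on_subset[OF c(1)] continuous_on_subset[OF c(2)] c; simp)+
  have p0: "pd i \<phi> x = 0" if "x \<notin> K" for x
    using pd_outside_compact(2)[OF K(1) \<phi>(2) that] .
  have u0: "u x = 0" if "x \<notin> K" for x using \<phi>(2) that by (simp add: u_def)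
  have v0: "v x = 0" if "x \<notin> K" for x using \<phi>(2) p0 that by (simp add: v_def)
  have dv: "u differentiable at x \<and> pd i u x = v x" for x
  proof (cases "x \<in> \<Omega>")
    case True
    have "(\<lambda>x. \<phi> x * g x) differentiable at x" by (intro differentiable_mult d\<phi> dg True)
    from pd_cong_open(1)[OF this \<Omega> True, of u] pd_cong_open(2)[OF this \<Omega> True, of u i] show ?thesis
      by (simp add: u_def v_def pd_mult[OF d\<phi> dg[OF True]] True)
  next
    case False
    then have "x \<notin> K" using K by blast
    from pd_outside_compact[OF K(1) u0 this] show ?thesis using False by (simp add: v_def)
  qed
  then have uv: "pd i u = v" by auto
  \<comment> \<open>The two open sets cover the space: on the first \<open>v\<close> is given by the
    product rule, on the second it is zero.\<close>
  have "continuous_on (\<Omega> \<union> - K) v"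
  proof (rule continuous_on_open_Un)
    show "open \<Omega>" "open (- K)" using \<Omega> K(1) by (auto simp: compact_imp_closed open_Compl)
    show "continuous_on \<Omega> v" using continuous_on_add[OF cp] by (simp add: v_def)
    show "continuous_on (- K) v"
      by (rule continuous_on_eq[OF continuous_on_const[of _ 0]]) (simp add: v0)
  qed
  moreover have "\<Omega> \<union> - K = UNIV" using K by auto
  ultimately have "integral\<^sup>L lborel v = 0"
    using integral_pd_compact_support[of u i K] dv K(1) u0 unfolding uv by simp
  then have "(\<integral>x. \<phi> x * pd i g x + pd i \<phi> x * g x \<partial>lebesgue_on \<Omega>) = 0"
    using compact_support_lebesgue_on(2)[OF \<Omega> K continuous_on_add[OF cp]] \<phi>(2) p0
    by (simp add: v_def[abs_def])
  moreover have "(\<integral>x. \<phi> x * pd i g x + pd i \<phi> x * g x \<partial>lebesgue_on \<Omega>)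
      = L2_inner \<Omega> \<phi> (pd i g) + L2_inner \<Omega> (pd i \<phi>) g"
    unfolding L2_inner_def inner_real_def
    by (intro Bochner_Integration.integral_add compact_support_lebesgue_on(1)[OF \<Omega> K] cp) (auto simp: \<phi>(2) p0)
  ultimately show ?thesis by simp
qed

section \<open>Square integrability by components, and gradients with compact support\<close>

lemma L2_compact_support:
  fixes u :: "real^3 \<Rightarrow> real"
  assumes \<Omega>: "open \<Omega>" and K: "compact K" "K \<subseteq> \<Omega>" and u: "continuous_on UNIV u" "\<And>x. x \<notin> K \<Longrightarrow> u x = 0"
  shows "u \<in> L2 \<Omega>"
proof -
  have c: "continuous_on \<Omega> u" using u(1) by (rule continuous_on_subset) simp
  have "integrable (lebesgue_on \<Omega>) (\<lambda>x. u x * u x)"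
    by (rule compact_support_lebesgue_on(1)[OF \<Omega> K continuous_on_mult[OF c c]]) (simp add: u(2))
  moreover have "u \<in> borel_measurable (lebesgue_on \<Omega>)"
    using continuous_imp_measurable_on_sets_lebesgue[OF c] \<Omega> by auto
  ultimately show ?thesis by (simp add: L2_iff_integrable_inner)
qed

lemma L2_component:
  fixes v :: "real^3 \<Rightarrow> real^3"
  assumes "v \<in> L2 \<Omega>"
  shows "(\<lambda>x. v x $ i) \<in> L2 \<Omega>"
proof -
  have m: "(\<lambda>x. v x $ i) \<in> borel_measurable (lebesgue_on \<Omega>)"
    by (rule measurable_compose[OF L2_measurable[OF assms] borel_measurable_continuous_onI])
      (intro continuous_intros)
  have "integrable (lebesgue_on \<Omega>) (\<lambda>x. (norm (v x $ i))\<^sup>2)"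
  proof (rule Bochner_Integration.integrable_bound)
    show "integrable (lebesgue_on \<Omega>) (\<lambda>x. (norm (v x))\<^sup>2)" using assms by (simp add: L2_def)
    show "AE x in lebesgue_on \<Omega>. norm ((norm (v x $ i))\<^sup>2) \<le> norm ((norm (v x))\<^sup>2)"
      by (simp add: power_mono component_le_norm_cart flip: abs_le_square_iff)
    show "(\<lambda>x. (norm (v x $ i))\<^sup>2) \<in> borel_measurable (lebesgue_on \<Omega>)" using m by measurable
  qed
  then show ?thesis using m by (simp add: L2_def)
qed

lemma L2_vecI:
  fixes v :: "real^3 \<Rightarrow> real^3"
  assumes "\<And>i. (\<lambda>x. v x $ i) \<in> L2 \<Omega>"
  shows "v \<in> L2 \<Omega>"
proof -
  have "(\<lambda>x. (v x $ i) *\<^sub>R axis i (1::real)) \<in> L2 \<Omega>" for i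
    using assms[of i] by (auto simp: L2_def norm_axis_1)
  then have "(\<lambda>x. \<Sum>i\<in>UNIV. (v x $ i) *\<^sub>R axis i (1::real)) \<in> L2 \<Omega>"
    by (rule L2_sum)
  moreover have "(\<lambda>x. \<Sum>i\<in>UNIV. (v x $ i) *\<^sub>R axis i 1) = v"
    by (rule ext) (simp only: basis_expansion scalar_mult_eq_scaleR[symmetric])
  ultimately show ?thesis by (simp only:)
qed

lemma L2_inner_vec:
  fixes v w :: "real^3 \<Rightarrow> real^3"
  assumes "v \<in> L2 \<Omega>" "w \<in> L2 \<Omega>"
  shows "L2_inner \<Omega> v w = (\<Sum>i\<in>UNIV. L2_inner \<Omega> (\<lambda>x. v x $ i) (\<lambda>x. w x $ i))"
  unfolding L2_inner_def inner_vec_def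
  using L2_inner_integrable[OF L2_component[OF assms(1)] L2_component[OF assms(2)]]
  by (intro Bochner_Integration.integral_sum) simp

lemma test_fun_Ck_on: "test_fun \<Omega> \<eta> \<Longrightarrow> Ck_on k U \<eta>"
  unfolding test_fun_def smooth_on_def by (blast intro: Ck_on_subset)

text \<open>Classical gradients are weak ones by parts: \<phi> carries the compact support and the
  test function plays the merely differentiable factor. This makes the gradient expandable in the
  eigenfields.\<close>

lemma grad_compact_support_potential:
  fixes \<phi> :: "real^3 \<Rightarrow> real"
  assumes \<Omega>: "open \<Omega>" and K: "compact K" "K \<subseteq> \<Omega>"
    and \<phi>: "Ck_on 1 UNIV \<phi>" "\<And>x. x \<notin> K \<Longrightarrow> \<phi> x = 0"
  shows "grad \<phi> \<in> potential_fields \<Omega>"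
proof -
  have p0: "pd i \<phi> x = 0" if "x \<notin> K" for x i
    using pd_outside_compact(2)[OF K(1) \<phi>(2) that] .
  have c: "continuous_on UNIV \<phi>" "continuous_on UNIV (pd i \<phi>)" for i
    using Ck_on_imp_continuous[OF \<phi>(1)] \<phi>(1) by auto
  have p: "pd i \<phi> \<in> L2 \<Omega>" for i by (rule L2_compact_support[OF \<Omega> K c(2) p0])
  have h: "\<phi> \<in> L2 \<Omega>" by (rule L2_compact_support[OF \<Omega> K c(1) \<phi>(2)])
  have "L2_inner \<Omega> \<phi> (pd i \<eta>) = - L2_inner \<Omega> (pd i \<phi>) \<eta>" if "test_fun \<Omega> \<eta>" for \<eta> i
    using integration_by_parts[OF \<Omega> K \<phi> test_fun_Ck_on[OF that]] by simp
  then have "weak_grad \<Omega> \<phi> (grad \<phi>)" using p h by (simp add: weak_grad_def weak_pd_def grad_def)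
  moreover have "grad \<phi> \<in> L2 \<Omega>" by (rule L2_vecI) (simp add: grad_def p)
  ultimately show ?thesis using h by (auto simp: potential_fields_def H1_def)
qed

section \<open>Expansions in an orthonormal system\<close>

definition orthonormal_system :: "(real^3) set \<Rightarrow> (nat \<Rightarrow> real^3 \<Rightarrow> real^3) \<Rightarrow> bool" where
  "orthonormal_system \<Omega> q \<longleftrightarrow> (\<forall>j. q j \<in> L2 \<Omega>) \<and> (\<forall>i j. L2_inner \<Omega> (q i) (q j) = (if i = j then 1 else 0))"

definition L2_partial_sum :: "(nat \<Rightarrow> real^3 \<Rightarrow> real^3) \<Rightarrow> (nat \<Rightarrow> real) \<Rightarrow> nat \<Rightarrow> real^3 \<Rightarrow> real^3" where
  "L2_partial_sum q c n x = (\<Sum>j<n. c j *\<^sub>R q j x)"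

context
  fixes \<Omega> :: "(real^3) set" and q :: "nat \<Rightarrow> real^3 \<Rightarrow> real^3"
  assumes q: "orthonormal_system \<Omega> q"
begin

lemma orthonormal_L2: "q j \<in> L2 \<Omega>"
  using q by (simp add: orthonormal_system_def)

lemma orthonormal_inner: "L2_inner \<Omega> (q i) (q j) = (if i = j then 1 else 0)"
  using q by (simp add: orthonormal_system_def)

lemma L2_finite_sum: "(\<lambda>x. \<Sum>j\<in>J. c j *\<^sub>R q j x) \<in> L2 \<Omega>"
  by (intro L2_intros orthonormal_L2)

lemma L2_inner_finite_sum_left:
  "h \<in> L2 \<Omega> \<Longrightarrow> L2_inner \<Omega> (\<lambda>x. \<Sum>j\<in>J. c j *\<^sub>R q j x) h = (\<Sum>j\<in>J. c j * L2_inner \<Omega> (q j) h)"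
  by (simp add: L2_inner_sum_left L2_scaleR orthonormal_L2 L2_inner_scaleR_left)

lemma L2_inner_finite_sum_basis:
  "finite J \<Longrightarrow> L2_inner \<Omega> (\<lambda>x. \<Sum>j\<in>J. c j *\<^sub>R q j x) (q i) = (if i \<in> J then c i else 0)"
  by (simp add: L2_inner_finite_sum_left orthonormal_L2 orthonormal_inner if_distrib[of "\<lambda>t. _ * t"] cong: if_cong)

lemma L2_inner_finite_sum_self:
  "finite J \<Longrightarrow> L2_inner \<Omega> (\<lambda>x. \<Sum>j\<in>J. c j *\<^sub>R q j x) (\<lambda>x. \<Sum>j\<in>J. c j *\<^sub>R q j x) = (\<Sum>j\<in>J. (c j)\<^sup>2)"
  by (simp add: L2_inner_finite_sum_left L2_finite_sum L2_inner_commute[of \<Omega> "q _"]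
      L2_inner_finite_sum_basis power2_eq_square)

text \<open>Completing the square in each coefficient: the last sum is the price for deviating from
  the Fourier coefficients. Best approximation, linearity of the closed span and its invariance
  under a.e. equality are all read off from this identity.\<close>

lemma L2_norm_diff_finite_sum:
  assumes f: "f \<in> L2 \<Omega>"
  shows "(L2_norm \<Omega> (\<lambda>x. f x - (\<Sum>j<n. c j *\<^sub>R q j x)))\<^sup>2
    = L2_inner \<Omega> f f - (\<Sum>j<n. (L2_inner \<Omega> f (q j))\<^sup>2) + (\<Sum>j<n. (L2_inner \<Omega> f (q j) - c j)\<^sup>2)"
proof -
  define s where "s = (\<lambda>x. \<Sum>j<n. c j *\<^sub>R q j x)"
  have s: "s \<in> L2 \<Omega>" unfolding s_def by (rule L2_finite_sum)
  have sf: "L2_inner \<Omega> s f = (\<Sum>j<n. c j * L2_inner \<Omega> f (q j))"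
    unfolding s_def by (simp add: L2_inner_finite_sum_left f L2_inner_commute[of \<Omega> f])
  have ss: "L2_inner \<Omega> s s = (\<Sum>j<n. (c j)\<^sup>2)" unfolding s_def by (simp add: L2_inner_finite_sum_self)
  have "(L2_norm \<Omega> (\<lambda>x. f x - s x))\<^sup>2 = L2_inner \<Omega> f f - 2 * L2_inner \<Omega> s f + L2_inner \<Omega> s s"
    using f s by (simp add: L2_norm_sq L2_inner_diff_left L2_inner_diff_right L2_diff L2_inner_commute[of \<Omega> f s])
  also have "\<dots> = L2_inner \<Omega> f f - (\<Sum>j<n. (L2_inner \<Omega> f (q j))\<^sup>2) + (\<Sum>j<n. (L2_inner \<Omega> f (q j) - c j)\<^sup>2)"
    by (simp add: sf ss power2_diff sum.distrib sum_subtractf sum_distrib_left mult_ac)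
  finally show ?thesis by (simp add: s_def)
qed

text \<open>\<open>closed_span\<close> provides unrelated coefficients for each \<epsilon>. Fourier
  coefficients of the same length do at least as well, and the error decreases with the length, so
  the Fourier series itself converges.\<close>

lemma closed_span_approx:
  assumes f: "f \<in> closed_span \<Omega> q"
  shows "(\<lambda>n. L2_norm \<Omega> (\<lambda>x. f x - L2_partial_sum q (\<lambda>j. L2_inner \<Omega> f (q j)) n x)) \<longlonglongrightarrow> 0"
proof (rule LIMSEQ_I)
  fix e :: real assume e: "e > 0"
  have fL: "f \<in> L2 \<Omega>" using f by (simp add: closed_span_def)
  define F where "F n = L2_norm \<Omega> (\<lambda>x. f x - L2_partial_sum q (\<lambda>j. L2_inner \<Omega> f (q j)) n x)" for n
  have F2: "(F n)\<^sup>2 = L2_inner \<Omega> f f - (\<Sum>j<n. (L2_inner \<Omega> f (q j))\<^sup>2)" for n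
    unfolding F_def L2_partial_sum_def by (simp add: L2_norm_diff_finite_sum[OF fL])
  obtain n c where n: "L2_norm \<Omega> (\<lambda>x. f x - (\<Sum>j<n. c j *\<^sub>R q j x)) < e"
    using f e by (auto simp: closed_span_def)
  have "F k < e" if "k \<ge> n" for k
  proof -
    have "(F k)\<^sup>2 \<le> (F n)\<^sup>2"
      unfolding F2 using that by (intro diff_mono sum_mono2) auto
    also have "\<dots> \<le> (L2_norm \<Omega> (\<lambda>x. f x - (\<Sum>j<n. c j *\<^sub>R q j x)))\<^sup>2"
      unfolding F2 L2_norm_diff_finite_sum[OF fL] by (simp add: sum_nonneg)
    finally show ?thesis using n L2_norm_nonneg by (meson le_less_trans power2_le_imp_le)
  qed
  moreover have "0 \<le> F k" for k unfolding F_def by (rule L2_norm_nonneg)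
  ultimately have "\<forall>k\<ge>n. norm (F k - 0) < e" by simp
  then show "\<exists>no. \<forall>n\<ge>no. norm (L2_norm \<Omega> (\<lambda>x. f x - L2_partial_sum q (\<lambda>j. L2_inner \<Omega> f (q j)) n x) - 0) < e"
    unfolding F_def by blast
qed

text \<open>The partial sums for \<open>f\<close> converge in norm, hence against every
  \<open>g\<close>. With the span condition on one factor alone, the formula can be applied to the
  gradient of a Laplacian, and to differences and combinations before they are known to lie in the
  span.\<close>

lemma Parseval_inner:
  assumes f: "f \<in> closed_span \<Omega> q" and g: "g \<in> L2 \<Omega>"
  shows "(\<lambda>j. L2_inner \<Omega> f (q j) * L2_inner \<Omega> g (q j)) sums L2_inner \<Omega> f g"
proof -
  have fL: "f \<in> L2 \<Omega>" using f by (simp add: closed_span_def)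
  have "(\<lambda>n. L2_norm \<Omega> (\<lambda>x. L2_partial_sum q (\<lambda>j. L2_inner \<Omega> f (q j)) n x - f x)) \<longlonglongrightarrow> 0"
    using closed_span_approx[OF f]
    by (simp add: L2_norm_def L2_inner_def inner_diff_left inner_diff_right algebra_simps)
  from tendsto_L2_inner[OF _ fL g this]
  show ?thesis
    unfolding sums_def
    by (simp add: L2_partial_sum_def[abs_def] L2_finite_sum L2_inner_finite_sum_left g L2_inner_commute[of \<Omega> g])
qed

text \<open>All coefficients of f - g vanish, so Parseval for \<open>f\<close> and for
  \<open>g\<close>, each against f - g, gives 0, and f - g is orthogonal to itself.\<close>

lemma closed_span_eqI:
  assumes f: "f \<in> closed_span \<Omega> q" and g: "g \<in> closed_span \<Omega> q"
    and eq: "\<And>j. L2_inner \<Omega> f (q j) = L2_inner \<Omega> g (q j)"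
  shows "L2_eq \<Omega> f g"
proof -
  have fL: "f \<in> L2 \<Omega>" and gL: "g \<in> L2 \<Omega>" using f g by (simp_all add: closed_span_def)
  have d: "(\<lambda>x. f x - g x) \<in> L2 \<Omega>" by (rule L2_diff[OF fL gL])
  have "L2_inner \<Omega> (\<lambda>x. f x - g x) (q j) = 0" for j
    using eq by (simp add: L2_inner_diff_left fL gL orthonormal_L2)
  then have "L2_inner \<Omega> f (\<lambda>x. f x - g x) = 0" "L2_inner \<Omega> g (\<lambda>x. f x - g x) = 0"
    using Parseval_inner[OF f d] Parseval_inner[OF g d] by (auto simp: sums_iff)
  then have "L2_inner \<Omega> (\<lambda>x. f x - g x) (\<lambda>x. f x - g x) = 0"
    by (simp add: L2_inner_diff_left fL gL d)
  then show ?thesis using L2_inner_self_eq_0_iff[OF d] L2_eq_diff_0 by blast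
qed

lemma closed_span_summable:
  assumes "f \<in> closed_span \<Omega> q"
  shows "summable (\<lambda>j. (L2_inner \<Omega> f (q j))\<^sup>2)"
  using Parseval_inner[OF assms] assms
  by (auto simp: power2_eq_square closed_span_def intro: sums_summable)

lemma closed_span_of_limit:
  assumes g: "g \<in> L2 \<Omega>" and lim: "(\<lambda>n. L2_norm \<Omega> (\<lambda>x. L2_partial_sum q c n x - g x)) \<longlonglongrightarrow> 0"
  shows "g \<in> closed_span \<Omega> q" "L2_inner \<Omega> g (q j) = c j"
proof -
  have "(\<lambda>n. L2_norm \<Omega> (\<lambda>x. g x - L2_partial_sum q c n x)) \<longlonglongrightarrow> 0"
    using lim by (simp add: L2_norm_def L2_inner_def inner_diff_left inner_diff_right algebra_simps)
  then have "\<exists>n. L2_norm \<Omega> (\<lambda>x. g x - L2_partial_sum q c n x) < e" if "e > 0" for e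
    using order_tendstoD(2)[OF _ that] by (metis (mono_tags, lifting) eventually_happens trivial_limit_sequentially)
  then show "g \<in> closed_span \<Omega> q" using g unfolding closed_span_def L2_partial_sum_def by blast
  have "(\<lambda>n. L2_inner \<Omega> (L2_partial_sum q c n) (q j)) \<longlonglongrightarrow> L2_inner \<Omega> g (q j)"
    by (rule tendsto_L2_inner[OF _ g orthonormal_L2 lim])
       (simp add: L2_partial_sum_def[abs_def] L2_finite_sum)
  \<comment> \<open>The term \<open>q j\<close> is present as soon as n > j, so this sequence is
    constant from \<open>Suc j\<close> on.\<close>
  moreover have "(\<lambda>n. L2_inner \<Omega> (L2_partial_sum q c n) (q j)) \<longlonglongrightarrow> c j"
    by (rule tendsto_eventually)
       (auto simp: L2_partial_sum_def[abs_def] L2_inner_finite_sum_basis eventually_sequentially intro!: exI[of _ "Suc j"])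
  ultimately show "L2_inner \<Omega> g (q j) = c j" by (rule LIMSEQ_unique)
qed

lemma Riesz_Fischer:
  assumes om: "\<Omega> \<in> lmeasurable" and c: "summable (\<lambda>j. (c j)\<^sup>2)"
  shows "\<exists>g\<in>L2 \<Omega>. (\<lambda>n. L2_norm \<Omega> (\<lambda>x. L2_partial_sum q c n x - g x)) \<longlonglongrightarrow> 0"
proof (rule L2_complete[OF om])
  show "L2_partial_sum q c n \<in> L2 \<Omega>" for n
    by (simp add: L2_partial_sum_def[abs_def] L2_finite_sum)
  have diff: "(L2_norm \<Omega> (\<lambda>x. L2_partial_sum q c j x - L2_partial_sum q c i x))\<^sup>2 = (\<Sum>k=i..<j. (c k)\<^sup>2)"
    if "i \<le> j" for i j
  proof -
    have "L2_partial_sum q c j x - L2_partial_sum q c i x = (\<Sum>k=i..<j. c k *\<^sub>R q k x)" for x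
      unfolding L2_partial_sum_def using sum_diff_nat_ivl[of 0 i j] that by (simp add: atLeast0LessThan)
    then show ?thesis by (simp add: L2_norm_sq L2_inner_finite_sum_self)
  qed
  have sym: "L2_norm \<Omega> (\<lambda>x. L2_partial_sum q c j x - L2_partial_sum q c i x)
      = L2_norm \<Omega> (\<lambda>x. L2_partial_sum q c i x - L2_partial_sum q c j x)" for i j
    by (simp add: L2_norm_def L2_inner_def inner_diff_left inner_diff_right algebra_simps)
  fix e :: real assume e: "e > 0"
  then obtain N where N: "\<And>m n. m \<ge> N \<Longrightarrow> norm (\<Sum>k=m..<n. (c k)\<^sup>2) < e\<^sup>2"
    using c unfolding summable_Cauchy by (meson zero_less_power)
  have "L2_norm \<Omega> (\<lambda>x. L2_partial_sum q c j x - L2_partial_sum q c i x) \<le> e" if "N \<le> i" "i \<le> j" for i j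
  proof -
    have "(L2_norm \<Omega> (\<lambda>x. L2_partial_sum q c j x - L2_partial_sum q c i x))\<^sup>2 \<le> e\<^sup>2"
      unfolding diff[OF that(2)] using N[OF that(1), of j] unfolding real_norm_def by linarith
    then show ?thesis by (rule power2_le_imp_le) (use e in simp)
  qed
  then show "\<exists>N. \<forall>i\<ge>N. \<forall>j\<ge>N. L2_norm \<Omega> (\<lambda>x. L2_partial_sum q c i x - L2_partial_sum q c j x) \<le> e"
    by (intro exI[of _ N] allI impI) (metis nat_le_linear sym)
qed

text \<open>Riesz-Fischer shows that the choice in \<open>L2_suminf\<close> ranges over a nonempty
  set; any limit of the series then has the prescribed coefficients.\<close>

lemma L2_suminf_closed_span:
  assumes om: "\<Omega> \<in> lmeasurable" and c: "summable (\<lambda>j. (c j)\<^sup>2)"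
  shows "L2_suminf \<Omega> (\<lambda>j y. c j *\<^sub>R q j y) \<in> closed_span \<Omega> q"
    and "L2_inner \<Omega> (L2_suminf \<Omega> (\<lambda>j y. c j *\<^sub>R q j y)) (q i) = c i"
proof -
  let ?g = "L2_suminf \<Omega> (\<lambda>j y. c j *\<^sub>R q j y)"
  have "\<exists>g. g \<in> L2 \<Omega> \<and> (\<lambda>n. L2_norm \<Omega> (\<lambda>x. (\<Sum>j<n. c j *\<^sub>R q j x) - g x)) \<longlonglongrightarrow> 0"
    using Riesz_Fischer[OF om c] by (auto simp: L2_partial_sum_def)
  from someI_ex[OF this]
  have "?g \<in> L2 \<Omega>" "(\<lambda>n. L2_norm \<Omega> (\<lambda>x. L2_partial_sum q c n x - ?g x)) \<longlonglongrightarrow> 0"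
    by (simp_all add: L2_suminf_def L2_partial_sum_def)
  from closed_span_of_limit[OF this]
  show "?g \<in> closed_span \<Omega> q" "L2_inner \<Omega> ?g (q i) = c i" by auto
qed

text \<open>Parseval for \<open>f\<close> and for \<open>g\<close> against the combination itself
  shows that its squared coefficients add up to its squared norm. By the distance identity its
  Fourier sums then converge to it.\<close>

lemma closed_span_lincomb:
  assumes f: "f \<in> closed_span \<Omega> q" and g: "g \<in> closed_span \<Omega> q"
  shows "(\<lambda>x. a *\<^sub>R f x + b *\<^sub>R g x) \<in> closed_span \<Omega> q"
proof -
  have fL: "f \<in> L2 \<Omega>" and gL: "g \<in> L2 \<Omega>" using f g by (simp_all add: closed_span_def)
  define c where "c j = a * L2_inner \<Omega> f (q j) + b * L2_inner \<Omega> g (q j)" for j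
  let ?w = "\<lambda>x. a *\<^sub>R f x + b *\<^sub>R g x"
  have wL: "?w \<in> L2 \<Omega>" by (intro L2_intros fL gL)
  have wc: "L2_inner \<Omega> ?w (q j) = c j" for j
    by (simp add: L2_inner_add_left L2_inner_scaleR_left L2_scaleR fL gL orthonormal_L2 c_def)
  have "(\<lambda>j. c j * c j) sums L2_inner \<Omega> ?w ?w"
  proof -
    have "(\<lambda>j. a * (L2_inner \<Omega> f (q j) * L2_inner \<Omega> ?w (q j)) + b * (L2_inner \<Omega> g (q j) * L2_inner \<Omega> ?w (q j)))
        sums (a * L2_inner \<Omega> f ?w + b * L2_inner \<Omega> g ?w)"
      by (intro sums_add sums_mult Parseval_inner f g wL)
    then show ?thesis
      by (simp add: wc c_def L2_inner_add_left L2_inner_scaleR_left L2_scaleR fL gL wL algebra_simps)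
  qed
  then have "(\<lambda>n. L2_inner \<Omega> ?w ?w - (\<Sum>j<n. (c j)\<^sup>2)) \<longlonglongrightarrow> L2_inner \<Omega> ?w ?w - L2_inner \<Omega> ?w ?w"
    unfolding sums_def power2_eq_square by (intro tendsto_diff tendsto_const)
  then have "(\<lambda>n. (L2_norm \<Omega> (\<lambda>x. ?w x - (\<Sum>j<n. c j *\<^sub>R q j x)))\<^sup>2) \<longlonglongrightarrow> 0"
    by (simp add: L2_norm_diff_finite_sum[OF wL] wc)
  then have lim: "(\<lambda>n. L2_norm \<Omega> (\<lambda>x. ?w x - (\<Sum>j<n. c j *\<^sub>R q j x))) \<longlonglongrightarrow> 0"
    using tendsto_real_sqrt[of "\<lambda>n. (L2_norm \<Omega> (\<lambda>x. ?w x - (\<Sum>j<n. c j *\<^sub>R q j x)))\<^sup>2" 0]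
    by (simp add: L2_norm_nonneg)
  have "\<exists>n c. L2_norm \<Omega> (\<lambda>x. ?w x - (\<Sum>j<n. c j *\<^sub>R q j x)) < e" if "e > 0" for e
    using order_tendstoD(2)[OF lim that] by (metis (mono_tags, lifting) eventually_happens trivial_limit_sequentially)
  then show ?thesis using wL unfolding closed_span_def by blast
qed

text \<open>The distance to a finite sum is determined by inner products, and these ignore null
  sets.\<close>

lemma closed_span_cong:
  assumes f: "f \<in> closed_span \<Omega> q" and g: "g \<in> L2 \<Omega>" and eq: "L2_eq \<Omega> g f"
  shows "g \<in> closed_span \<Omega> q"
proof -
  have fL: "f \<in> L2 \<Omega>" using f by (simp add: closed_span_def)
  have "L2_norm \<Omega> (\<lambda>x. g x - (\<Sum>j<n. c j *\<^sub>R q j x)) = L2_norm \<Omega> (\<lambda>x. f x - (\<Sum>j<n. c j *\<^sub>R q j x))" for n c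
  proof -
    have "L2_inner \<Omega> g h = L2_inner \<Omega> f h" if "h \<in> L2 \<Omega>" for h by (rule L2_inner_cong[OF eq g fL that])
    moreover from this have "L2_inner \<Omega> g g = L2_inner \<Omega> f f" using fL g by (metis L2_inner_commute)
    ultimately have "(L2_norm \<Omega> (\<lambda>x. g x - (\<Sum>j<n. c j *\<^sub>R q j x)))\<^sup>2 = (L2_norm \<Omega> (\<lambda>x. f x - (\<Sum>j<n. c j *\<^sub>R q j x)))\<^sup>2"
      unfolding L2_norm_diff_finite_sum[OF fL] L2_norm_diff_finite_sum[OF g] by (simp add: orthonormal_L2)
    then show ?thesis by (simp add: L2_norm_nonneg)
  qed
  then show ?thesis using f g by (simp add: closed_span_def)
qed

end

section \<open>The spectrum\<close>

text \<open>The field turns about an axis through \<open>c\<close> with a radial profile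
  \<open>g\<close>. Its divergence is the pairing of grad g with the rotation direction, and the
  gradient of a radial function is perpendicular to rotations. The index 2 of the profile matches
  the C^2 condition in \<open>Sp_grad_div\<close>.\<close>

lemma zero_in_Sp_grad_div:
  assumes \<Omega>: "open \<Omega>" "\<Omega> \<noteq> {}"
  shows "0 \<in> Sp_grad_div \<Omega>"
proof -
  obtain c where c: "c \<in> \<Omega>" using \<Omega> by blast
  obtain r where r: "r > 0" "ball c r \<subseteq> \<Omega>" using \<Omega>(1) c openE by blast
  define g where "g = bump c r 2"
  have gC: "Ck_on 2 UNIV g" unfolding g_def by (rule Ck_on_bump)
  have gd: "g differentiable at x" for x using Ck_on_le[OF gC, of 1] by simp
  have pg: "pd i g x = - 6 * (x $ i - c $ i) * bump c r 1 x" for i x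
    unfolding g_def using pd_bump[of i c r 1 x] by (simp add: numeral_2_eq_2)
  \<comment> \<open>a rotation field with compact support: it is divergence free\<close>
  define v :: "real^3 \<Rightarrow> real^3" where
    "v x = ((x $ 2 - c $ 2) * g x) *\<^sub>R axis 1 (-1) + ((x $ 1 - c $ 1) * g x) *\<^sub>R axis 2 1" for x
  have v1: "(\<lambda>y. v y $ 1) = (\<lambda>y. (-1) * ((y $ 2 - c $ 2) * g y))"
    and v2: "(\<lambda>y. v y $ 2) = (\<lambda>y. (y $ 1 - c $ 1) * g y)" and v3: "(\<lambda>y. v y $ 3) = (\<lambda>y. 0)"
    by (auto simp: v_def axis_def)
  have L: "bounded_linear (\<lambda>t::real. t *\<^sub>R a)" for a :: "real^3" by (rule bounded_linear_scaleR_left)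
  have vC: "Ck_on 2 UNIV v"
    unfolding v_def[abs_def]
    by (intro Ck_on_add Ck_on_bounded_linear[OF _ L] Ck_on_mult Ck_on_coordinate_diff gC open_UNIV)
  have "divg v x = 0" for x
  proof -
    have "divg v x = (-1) * pd 1 (\<lambda>y. (y $ 2 - c $ 2) * g y) x + pd 2 (\<lambda>y. (y $ 1 - c $ 1) * g y) x"
      by (simp only: divg_def sum_3 v1 v2 v3 pd_const,
          subst pd_cmult, intro differentiable_mult coordinate_diff_differentiable gd, simp)
    also have "\<dots> = 0"
      by (simp add: pd_mult[OF coordinate_diff_differentiable gd] pd_coordinate_diff pg)
        (simp add: algebra_simps)
    finally show ?thesis .
  qed
  then have "grad (divg v) x = 0" for x
    by (simp add: grad_def vec_eq_iff)
       (metis (no_types, lifting) ext pd_const)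
  moreover have "v x = 0" if "x \<notin> \<Omega>" for x
  proof -
    have "x \<notin> ball c r" using that r(2) by blast
    then show ?thesis using bump_outside[of r x c 2] r(1) by (simp add: v_def g_def)
  qed
  \<comment> \<open>The frontier of an open set is disjoint from it, so \<open>v\<close> is zero
    there, whatever \<open>unit_normal\<close> returns.\<close>
  then have "tangential \<Omega> v" using \<Omega>(1) by (auto simp: tangential_def frontier_def interior_open)
  moreover have "\<exists>x\<in>\<Omega>. v x \<noteq> 0"
  proof
    \<comment> \<open>Moving from \<open>c\<close> along the first axis makes the second component
      of \<open>v\<close> equal to (r / 2) times a positive value of \<open>g\<close>.\<close>
    let ?x = "c + (r / 2) *\<^sub>R axis 1 1 :: real^3"
    have b: "?x \<in> ball c r" using r(1) by (simp add: dist_norm norm_axis_1)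
    then show "?x \<in> \<Omega>" using r(2) by blast
    have "v ?x $ 2 = (r / 2) * g ?x" using fun_cong[OF v2, of ?x] by (simp add: axis_def)
    moreover have "(r / 2) * g ?x > 0" using bump_pos[OF b, of 2] r(1) by (simp add: g_def)
    ultimately have "v ?x $ 2 \<noteq> 0" by linarith
    then show "v ?x \<noteq> 0" by (metis zero_index)
  qed
  ultimately show ?thesis
    using Ck_on_subset[OF vC] continuous_on_subset[OF Ck_on_imp_continuous[OF vC]]
    by (auto simp: Sp_grad_div_def)
qed

lemma eigenvalue_in_Sp_grad_div:
  assumes "smooth_up_to_boundary \<Omega> v" "tangential \<Omega> v" "L2_inner \<Omega> v v \<noteq> 0"
    and "\<And>x. x \<in> \<Omega> \<Longrightarrow> - grad (divg v) x = \<kappa> *\<^sub>R v x"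
  shows "\<kappa> \<in> Sp_grad_div \<Omega>"
proof -
  obtain U where U: "closure \<Omega> \<subseteq> U" "\<And>k. Ck_on k U v"
    using assms(1) by (auto simp: smooth_up_to_boundary_def smooth_on_def)
  have "Ck_on 2 \<Omega> v" using Ck_on_subset[OF U(2)] U(1) closure_subset by blast
  moreover have "continuous_on (closure \<Omega>) v"
    using Ck_on_imp_continuous[OF U(2)] U(1) continuous_on_subset by blast
  moreover have "\<exists>x\<in>\<Omega>. v x \<noteq> 0"
  proof (rule ccontr)
    assume "\<not> ?thesis"
    then have "L2_inner \<Omega> v v = (\<integral>x. 0 \<partial>lebesgue_on \<Omega>)"
      unfolding L2_inner_def by (intro Bochner_Integration.integral_cong) auto
    then show False using assms(3) by simp
  qed
  ultimately show ?thesis using assms(2,4) by (auto simp: Sp_grad_div_def)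
qed

subsection \<open>Unboundedness of the eigenvalues\<close>

definition laplacian :: "(real^3 \<Rightarrow> real) \<Rightarrow> real^3 \<Rightarrow> real" where
  "laplacian h x = (\<Sum>i\<in>UNIV. pd i (pd i h) x)"

lemma L2_inner_AM_GM:
  fixes f g :: "real^3 \<Rightarrow> real"
  assumes "f \<in> L2 \<Omega>" "g \<in> L2 \<Omega>" "\<And>x. x \<in> \<Omega> \<Longrightarrow> u x \<le> \<alpha> * (f x)\<^sup>2 + \<beta> * (g x)\<^sup>2"
    and u: "integrable (lebesgue_on \<Omega>) u"
  shows "integral\<^sup>L (lebesgue_on \<Omega>) u \<le> \<alpha> * L2_inner \<Omega> f f + \<beta> * L2_inner \<Omega> g g"
proof -
  have i: "integrable (lebesgue_on \<Omega>) (\<lambda>x. (f x)\<^sup>2)" "integrable (lebesgue_on \<Omega>) (\<lambda>x. (g x)\<^sup>2)"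
    using assms(1,2) by (simp_all add: L2_def)
  have "integral\<^sup>L (lebesgue_on \<Omega>) u \<le> (\<integral>x. \<alpha> * (f x)\<^sup>2 + \<beta> * (g x)\<^sup>2 \<partial>lebesgue_on \<Omega>)"
    using assms(3) i by (intro integral_mono u) auto
  then show ?thesis using i by (simp add: L2_inner_def power2_eq_square)
qed

text \<open>Class C^3 makes \<open>laplacian \<phi>\<close> continuously differentiable, so that its
  gradient is continuous and square integrable.\<close>

locale compactly_supported =
  fixes \<Omega> K :: "(real^3) set" and \<phi> :: "real^3 \<Rightarrow> real"
  assumes \<Omega>: "open \<Omega>" and K: "compact K" "K \<subseteq> \<Omega>"
    and C3: "Ck_on 3 UNIV \<phi>" and outside: "\<And>x. x \<notin> K \<Longrightarrow> \<phi> x = 0"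
begin

lemma Ck: "Ck_on 1 UNIV \<phi>" "Ck_on 2 UNIV (pd i \<phi>)" "Ck_on 1 UNIV (pd i \<phi>)"
    "Ck_on 1 UNIV (pd i (pd i \<phi>))" "Ck_on 1 UNIV (laplacian \<phi>)"
proof -
  show p2: "Ck_on 2 UNIV (pd i \<phi>)" for i using C3 by (simp add: numeral_3_eq_3 numeral_2_eq_2)
  show "Ck_on 1 UNIV \<phi>" "Ck_on 1 UNIV (pd i \<phi>)" using Ck_on_le[OF C3, of 1] Ck_on_le[OF p2, of 1] by simp_all
  show p1: "Ck_on 1 UNIV (pd i (pd i \<phi>))" for i using p2[of i] by (simp add: numeral_2_eq_2)
  show "Ck_on 1 UNIV (laplacian \<phi>)"
    unfolding laplacian_def[abs_def] by (rule Ck_on_sum[OF open_UNIV p1])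
qed

lemma pd_outside: "x \<notin> K \<Longrightarrow> pd i \<phi> x = 0"
  using pd_outside_compact(2)[OF K(1) outside] .

lemma pd_pd_outside: "x \<notin> K \<Longrightarrow> pd i (pd i \<phi>) x = 0"
  using pd_outside_compact(2)[OF K(1) pd_outside] .

lemma laplacian_outside: "x \<notin> K \<Longrightarrow> laplacian \<phi> x = 0"
  by (simp add: laplacian_def pd_pd_outside)

lemma L2_Ck_outside: "Ck_on k UNIV u \<Longrightarrow> (\<And>x. x \<notin> K \<Longrightarrow> u x = 0) \<Longrightarrow> u \<in> L2 \<Omega>"
  for u :: "real^3 \<Rightarrow> real"
  using L2_compact_support[OF \<Omega> K Ck_on_imp_continuous] .

lemma in_L2: "\<phi> \<in> L2 \<Omega>" "pd i \<phi> \<in> L2 \<Omega>" "pd i (pd i \<phi>) \<in> L2 \<Omega>" "laplacian \<phi> \<in> L2 \<Omega>"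
  by (rule L2_Ck_outside[OF Ck(1) outside] L2_Ck_outside[OF Ck(3) pd_outside]
      L2_Ck_outside[OF Ck(4) pd_pd_outside] L2_Ck_outside[OF Ck(5) laplacian_outside]; assumption)+

lemma grad_in_L2: "grad \<phi> \<in> L2 \<Omega>"
  by (rule L2_vecI) (simp add: grad_def in_L2)

lemma grad_inner_self: "L2_inner \<Omega> (grad \<phi>) (grad \<phi>) = (\<Sum>i\<in>UNIV. L2_inner \<Omega> (pd i \<phi>) (pd i \<phi>))"
  by (simp add: L2_inner_vec grad_in_L2) (simp add: grad_def)

lemma grad_laplacian_in_L2: "grad (laplacian \<phi>) \<in> L2 \<Omega>"
proof (rule L2_vecI)
  fix i
  have "continuous_on UNIV (pd i (laplacian \<phi>))" using Ck(5) by simp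
  then show "(\<lambda>x. grad (laplacian \<phi>) x $ i) \<in> L2 \<Omega>"
    using L2_compact_support[OF \<Omega> K, of "pd i (laplacian \<phi>)"]
      pd_outside_compact(2)[OF K(1) laplacian_outside] by (simp add: grad_def)
qed

lemma inner_grad_self: "L2_inner \<Omega> (grad \<phi>) (grad \<phi>) = - L2_inner \<Omega> \<phi> (laplacian \<phi>)"
proof -
  have "L2_inner \<Omega> (pd i \<phi>) (pd i \<phi>) = - L2_inner \<Omega> (pd i (pd i \<phi>)) \<phi>" for i
    using integration_by_parts[OF \<Omega> K Ck(1) outside Ck_on_subset[OF Ck(3)], of i i]
      L2_inner_commute[of \<Omega> \<phi>] by simp
  then show ?thesis
    unfolding grad_inner_self L2_inner_commute[of \<Omega> \<phi>] laplacian_def[abs_def]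
    by (simp add: L2_inner_sum_left in_L2 sum_negf)
qed

lemma inner_grad_laplacian_grad:
  "L2_inner \<Omega> (grad (laplacian \<phi>)) (grad \<phi>) = - L2_inner \<Omega> (laplacian \<phi>) (laplacian \<phi>)"
proof -
  have "L2_inner \<Omega> (pd i (laplacian \<phi>)) (pd i \<phi>) = - L2_inner \<Omega> (pd i (pd i \<phi>)) (laplacian \<phi>)" for i
    using integration_by_parts[OF \<Omega> K Ck(5) laplacian_outside Ck_on_subset[OF Ck(3)], of i i]
      L2_inner_commute[of \<Omega> "laplacian \<phi>"] by simp
  then have "L2_inner \<Omega> (grad (laplacian \<phi>)) (grad \<phi>) = (\<Sum>i\<in>UNIV. - L2_inner \<Omega> (pd i (pd i \<phi>)) (laplacian \<phi>))"
    using L2_inner_vec[OF grad_laplacian_in_L2 grad_in_L2] by (simp add: grad_def)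
  also have "\<dots> = - L2_inner \<Omega> (laplacian \<phi>) (laplacian \<phi>)"
    using L2_inner_sum_left[of UNIV "\<lambda>i. pd i (pd i \<phi>)" \<Omega> "laplacian \<phi>"] in_L2
    by (simp add: laplacian_def[abs_def] sum_negf)
  finally show ?thesis .
qed

text \<open>No boundary condition on \<open>v\<close> enters, since \<open>\<phi>\<close> vanishes near the boundary.\<close>
lemma inner_grad_laplacian_eigenfield:
  assumes v: "Ck_on 2 \<Omega> v" "v \<in> L2 \<Omega>" and eig: "\<And>x. x \<in> \<Omega> \<Longrightarrow> - grad (divg v) x = \<kappa> *\<^sub>R v x"
  shows "L2_inner \<Omega> (grad (laplacian \<phi>)) v = - \<kappa> * L2_inner \<Omega> (grad \<phi>) v"
proof -
  have vi: "Ck_on 2 \<Omega> (\<lambda>x. v x $ i)" for i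
    by (rule Ck_on_bounded_linear[OF \<Omega> bounded_linear_vec_nth v(1)])
  then have pvi: "Ck_on 1 \<Omega> (pd i (\<lambda>x. v x $ i))" for i by (simp add: numeral_2_eq_2)
  have dv: "Ck_on 1 \<Omega> (divg v)"
    unfolding divg_def[abs_def] by (rule Ck_on_sum[OF \<Omega> pvi])
  have c: "continuous_on \<Omega> (laplacian \<phi>)" "continuous_on \<Omega> (pd i (\<lambda>x. v x $ i))"
      "continuous_on \<Omega> (divg v)" "continuous_on \<Omega> (pd i (pd i \<phi>))" for i
    using Ck_on_imp_continuous[OF Ck_on_subset[OF Ck(5)]] Ck_on_imp_continuous[OF pvi]
      Ck_on_imp_continuous[OF dv] Ck_on_imp_continuous[OF Ck_on_subset[OF Ck(4)]] by auto
  have "L2_inner \<Omega> (grad (laplacian \<phi>)) v = (\<Sum>i\<in>UNIV. L2_inner \<Omega> (pd i (laplacian \<phi>)) (\<lambda>x. v x $ i))"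
    using L2_inner_vec[OF grad_laplacian_in_L2 v(2)] by (simp add: grad_def)
  \<comment> \<open>Two integrations by parts carry grad div from the test side to \<open>v\<close>;
    in each of them the compactly supported factor is a derivative of \<phi>. Here the first one
    produces div v.\<close>
  also have "\<dots> = (\<Sum>i\<in>UNIV. - L2_inner \<Omega> (laplacian \<phi>) (pd i (\<lambda>x. v x $ i)))"
    by (intro sum.cong refl integration_by_parts[OF \<Omega> K Ck(5) laplacian_outside] Ck_on_le[OF vi]) auto
  also have "\<dots> = - L2_inner \<Omega> (laplacian \<phi>) (divg v)"
    unfolding L2_inner_def divg_def inner_real_def sum_distrib_left
    by (subst Bochner_Integration.integral_sum)
       (auto simp: sum_negf laplacian_outside intro!: compact_support_lebesgue_on(1)[OF \<Omega> K] continuous_on_mult c)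
  \<comment> \<open>The Laplacian is split into pure second derivatives, so the second integration
    by parts removes one \<open>pd i\<close> from each term and no mixed derivatives have to be
    interchanged.\<close>
  also have "\<dots> = - (\<Sum>i\<in>UNIV. L2_inner \<Omega> (pd i (pd i \<phi>)) (divg v))"
    unfolding L2_inner_def laplacian_def inner_real_def sum_distrib_right
    by (subst Bochner_Integration.integral_sum)
       (auto simp: pd_pd_outside intro!: compact_support_lebesgue_on(1)[OF \<Omega> K] continuous_on_mult c)
  also have "\<dots> = (\<Sum>i\<in>UNIV. L2_inner \<Omega> (pd i \<phi>) (pd i (divg v)))"
    unfolding sum_negf[symmetric]
    by (intro sum.cong refl) (simp add: integration_by_parts[OF \<Omega> K Ck(3) pd_outside dv])
  also have "\<dots> = (\<Sum>i\<in>UNIV. - \<kappa> * L2_inner \<Omega> (pd i \<phi>) (\<lambda>x. v x $ i))"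
  proof (intro sum.cong refl)
    fix i :: 3
    have "pd i (divg v) x = - \<kappa> * v x $ i" if "x \<in> \<Omega>" for x
      using arg_cong[OF eig[OF that], of "\<lambda>w. - w $ i"] by (simp add: grad_def)
    then have "L2_inner \<Omega> (pd i \<phi>) (pd i (divg v)) = (\<integral>x. - \<kappa> * (pd i \<phi> x * v x $ i) \<partial>lebesgue_on \<Omega>)"
      unfolding L2_inner_def by (intro Bochner_Integration.integral_cong) auto
    then show "L2_inner \<Omega> (pd i \<phi>) (pd i (divg v)) = - \<kappa> * L2_inner \<Omega> (pd i \<phi>) (\<lambda>x. v x $ i)"
      by (simp add: L2_inner_def)
  qed
  also have "\<dots> = - \<kappa> * L2_inner \<Omega> (grad \<phi>) v"
    using L2_inner_vec[OF grad_in_L2 v(2)] by (simp add: grad_def sum_distrib_left)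
  finally show ?thesis .
qed

text \<open>Integrate \<open>1 = pd 1 (\<lambda>x. x $ 1 - c $ 1)\<close> against \<open>\<phi>\<^sup>2\<close> by parts.\<close>
lemma Poincare:
  assumes Kr: "K \<subseteq> cball c r"
  shows "L2_inner \<Omega> \<phi> \<phi> \<le> 4 * r\<^sup>2 * L2_inner \<Omega> (grad \<phi>) (grad \<phi>)"
proof -
  let ?l = "\<lambda>x::real^3. x $ 1 - c $ 1"
  have \<phi>d: "\<phi> differentiable at x" for x using Ck(1) by simp
  have C: "Ck_on 1 UNIV (\<lambda>x. ?l x * \<phi> x)" by (intro Ck_on_mult Ck_on_coordinate_diff Ck open_UNIV)
  have p: "pd 1 (\<lambda>x. ?l x * \<phi> x) = (\<lambda>x. ?l x * pd 1 \<phi> x + \<phi> x)"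
    by (rule ext) (simp add: pd_mult[OF coordinate_diff_differentiable \<phi>d] pd_coordinate_diff)
  have c: "continuous_on \<Omega> \<phi>" "continuous_on \<Omega> (pd 1 \<phi>)" "continuous_on \<Omega> ?l"
    using Ck_on_imp_continuous[OF Ck_on_subset[OF Ck(1)]] Ck_on_imp_continuous[OF Ck_on_subset[OF Ck(3)]]
    by (auto intro!: continuous_intros)
  have i: "integrable (lebesgue_on \<Omega>) (\<lambda>x. ?l x * pd 1 \<phi> x * \<phi> x)"
    by (rule compact_support_lebesgue_on(1)[OF \<Omega> K]) (auto intro!: continuous_on_mult c simp: outside)
  have "L2_inner \<Omega> (pd 1 \<phi>) (\<lambda>x. ?l x * \<phi> x) = - L2_inner \<Omega> \<phi> (\<lambda>x. ?l x * pd 1 \<phi> x + \<phi> x)"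
    using integration_by_parts[OF \<Omega> K Ck(1) outside Ck_on_subset[OF C], of 1] unfolding p by simp
  moreover have "L2_inner \<Omega> (pd 1 \<phi>) (\<lambda>x. ?l x * \<phi> x) = (\<integral>x. ?l x * pd 1 \<phi> x * \<phi> x \<partial>lebesgue_on \<Omega>)"
    by (simp add: L2_inner_def mult_ac)
  moreover have "L2_inner \<Omega> \<phi> (\<lambda>x. ?l x * pd 1 \<phi> x + \<phi> x)
      = (\<integral>x. ?l x * pd 1 \<phi> x * \<phi> x \<partial>lebesgue_on \<Omega>) + L2_inner \<Omega> \<phi> \<phi>"
    using Bochner_Integration.integral_add[OF i L2_inner_integrable[OF in_L2(1) in_L2(1)]]
    by (simp add: L2_inner_def algebra_simps)
  ultimately have "L2_inner \<Omega> \<phi> \<phi> = (\<integral>x. - 2 * (?l x * pd 1 \<phi> x * \<phi> x) \<partial>lebesgue_on \<Omega>)"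
    by simp
  \<comment> \<open>Young's inequality with weight 1/2 on \<phi>^2, so that this half is absorbed on
    the left; doubling the other weight 2 r^2 gives the constant 4 r^2.\<close>
  also have "\<dots> \<le> (1 / 2) * L2_inner \<Omega> \<phi> \<phi> + 2 * r\<^sup>2 * L2_inner \<Omega> (pd 1 \<phi>) (pd 1 \<phi>)"
  proof (rule L2_inner_AM_GM[OF in_L2(1) in_L2(2)])
    show "integrable (lebesgue_on \<Omega>) (\<lambda>x. - 2 * (?l x * pd 1 \<phi> x * \<phi> x))" using i by simp
    fix x
    show "- 2 * (?l x * pd 1 \<phi> x * \<phi> x) \<le> (1 / 2) * (\<phi> x)\<^sup>2 + 2 * r\<^sup>2 * (pd 1 \<phi> x)\<^sup>2"
    proof (cases "x \<in> K")
      case True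
      then have "norm (x - c) \<le> r" using Kr by (auto simp: dist_norm norm_minus_commute)
      then have "\<bar>?l x\<bar> \<le> r" using component_le_norm_cart[of "x - c" 1] by simp
      then have "(?l x)\<^sup>2 \<le> r\<^sup>2" using abs_le_square_iff by fastforce
      then have "2 * ((?l x)\<^sup>2 * (pd 1 \<phi> x)\<^sup>2) \<le> 2 * (r\<^sup>2 * (pd 1 \<phi> x)\<^sup>2)" by (simp add: mult_right_mono)
      \<comment> \<open>This is (s + 2 t)^2 \<ge> 0, with s = \<phi> and t the coordinate times the
        derivative.\<close>
      moreover have "0 \<le> s\<^sup>2 + 4 * (t * s) + 4 * t\<^sup>2" for s t :: real
        using zero_le_power2[of "s + 2 * t"] by (simp add: power2_sum power_mult_distrib mult_ac)
      from this[of "\<phi> x" "?l x * pd 1 \<phi> x"]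
      have "0 \<le> (\<phi> x)\<^sup>2 + 4 * (?l x * pd 1 \<phi> x * \<phi> x) + 4 * ((?l x)\<^sup>2 * (pd 1 \<phi> x)\<^sup>2)"
        by (simp only: power_mult_distrib)
      ultimately show ?thesis by linarith
    qed (simp add: outside)
  qed
  finally have "L2_inner \<Omega> \<phi> \<phi> \<le> 4 * r\<^sup>2 * L2_inner \<Omega> (pd 1 \<phi>) (pd 1 \<phi>)" by simp
  also have "\<dots> \<le> 4 * r\<^sup>2 * L2_inner \<Omega> (grad \<phi>) (grad \<phi>)"
    unfolding grad_inner_self sum_3 by (intro mult_left_mono) (simp_all add: L2_inner_self_nonneg)
  finally show ?thesis .
qed

text \<open>Estimate -(\<phi>, \<Delta>\<phi>) by Young's inequality. The weight 1 / (8 r^2) is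
  chosen so that the Poincare constant 4 r^2 turns the first term into half of the left side, which
  is absorbed.\<close>

lemma grad_le_laplacian:
  assumes Kr: "K \<subseteq> cball c r" and r: "r > 0"
  shows "L2_inner \<Omega> (grad \<phi>) (grad \<phi>) \<le> 4 * r\<^sup>2 * L2_inner \<Omega> (laplacian \<phi>) (laplacian \<phi>)"
proof -
  have "L2_inner \<Omega> (grad \<phi>) (grad \<phi>) = (\<integral>x. - (\<phi> x * laplacian \<phi> x) \<partial>lebesgue_on \<Omega>)"
    unfolding inner_grad_self by (simp add: L2_inner_def)
  also have "\<dots> \<le> (1 / (8 * r\<^sup>2)) * L2_inner \<Omega> \<phi> \<phi> + 2 * r\<^sup>2 * L2_inner \<Omega> (laplacian \<phi>) (laplacian \<phi>)"
  proof (rule L2_inner_AM_GM[OF in_L2(1) in_L2(4)])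
    show "integrable (lebesgue_on \<Omega>) (\<lambda>x. - (\<phi> x * laplacian \<phi> x))"
      using L2_inner_integrable[OF in_L2(1) in_L2(4)] by simp
    fix x
    have "0 \<le> (\<phi> x + 4 * r\<^sup>2 * laplacian \<phi> x)\<^sup>2 / (8 * r\<^sup>2)" by simp
    also have "\<dots> = (1 / (8 * r\<^sup>2)) * (\<phi> x)\<^sup>2 + \<phi> x * laplacian \<phi> x + 2 * r\<^sup>2 * (laplacian \<phi> x)\<^sup>2"
      using r by (simp add: power2_sum field_simps power2_eq_square)
    finally show "- (\<phi> x * laplacian \<phi> x) \<le> (1 / (8 * r\<^sup>2)) * (\<phi> x)\<^sup>2 + 2 * r\<^sup>2 * (laplacian \<phi> x)\<^sup>2" by simp
  qed
  also have "(1 / (8 * r\<^sup>2)) * L2_inner \<Omega> \<phi> \<phi> \<le> (1 / (8 * r\<^sup>2)) * (4 * r\<^sup>2 * L2_inner \<Omega> (grad \<phi>) (grad \<phi>))"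
    using Poincare[OF Kr] r by (intro mult_left_mono) simp_all
  also have "\<dots> = (1 / 2) * L2_inner \<Omega> (grad \<phi>) (grad \<phi>)" using r by simp
  finally show ?thesis by simp
qed

end

lemma eigenvalues_unbounded:
  assumes \<Omega>: "open \<Omega>" "\<Omega> \<noteq> {}"
    and basis: "orthonormal_basis \<Omega> (potential_fields \<Omega>) q"
    and smooth: "\<And>j. Ck_on 2 \<Omega> (q j)"
    and eigen: "\<And>j x. x \<in> \<Omega> \<Longrightarrow> - grad (divg (q j)) x = ev j *\<^sub>R q j x"
  shows "\<exists>j. b < ev j"
proof (rule ccontr)
  assume "\<not> (\<exists>j. b < ev j)"
  then have b: "ev j \<le> b" for j by (simp add: not_less)
  have q: "orthonormal_system \<Omega> q" and span: "closed_span \<Omega> q = potential_fields \<Omega>"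
    using basis by (auto simp: orthonormal_basis_def orthonormal_system_def potential_fields_def)
  obtain c where c: "c \<in> \<Omega>" using \<Omega> by blast
  obtain R where R: "R > 0" "cball c R \<subseteq> \<Omega>" using \<Omega>(1) c open_contains_cball by blast
  \<comment> \<open>The first bound keeps the ball inside the domain. The second gives 4 r^2 (|b| +
    1) \<le> r \<le> 1/4, which makes 4 r^2 b < 1 whatever the sign of \<open>b\<close>.\<close>
  define r where "r = min R (1 / (4 * (\<bar>b\<bar> + 1)))"
  have r: "0 < r" "r \<le> R" using R by (simp_all add: r_def)
  have "r \<le> 1 / (4 * (\<bar>b\<bar> + 1))" by (simp add: r_def)
  then have rb: "r * (4 * (\<bar>b\<bar> + 1)) \<le> 1" by (simp add: field_simps)
  have "r * 4 \<le> r * (4 * (\<bar>b\<bar> + 1))" using r(1) by simp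
  with rb have r1: "4 * r \<le> 1" by simp
  have "4 * r\<^sup>2 * b \<le> 4 * r\<^sup>2 * (\<bar>b\<bar> + 1)" by (intro mult_left_mono) auto
  also have "\<dots> = r * (4 * (\<bar>b\<bar> + 1)) * r" by (simp add: power2_eq_square)
  also have "\<dots> \<le> 1 * r" using rb r(1) by (intro mult_right_mono) auto
  finally have small: "4 * r\<^sup>2 * b < 1" using r1 by simp
  interpret compactly_supported \<Omega> "cball c r" "bump c r 3"
    using \<Omega>(1) R r Ck_on_bump[of 3 c r] bump_outside[of r _ c 3]
    by unfold_locales (auto intro: subset_trans[OF subset_cball])
  let ?\<phi> = "bump c r 3"
  have G: "grad ?\<phi> \<in> closed_span \<Omega> q"
    unfolding span by (rule grad_compact_support_potential[OF \<Omega>(1) K Ck(1) outside])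
  define a where "a j = L2_inner \<Omega> (grad ?\<phi>) (q j)" for j
  have s1: "(\<lambda>j. (a j)\<^sup>2) sums L2_inner \<Omega> (grad ?\<phi>) (grad ?\<phi>)"
    using Parseval_inner[OF q G grad_in_L2] by (simp add: a_def power2_eq_square)
  have "L2_inner \<Omega> (grad (laplacian ?\<phi>)) (q j) = - ev j * a j" for j
    unfolding a_def by (rule inner_grad_laplacian_eigenfield[OF smooth orthonormal_L2[OF q] eigen])
  with Parseval_inner[OF q G grad_laplacian_in_L2]
  have "(\<lambda>j. - (ev j * (a j)\<^sup>2)) sums (- L2_inner \<Omega> (laplacian ?\<phi>) (laplacian ?\<phi>))"
    using inner_grad_laplacian_grad L2_inner_commute[of \<Omega> "grad ?\<phi>" "grad (laplacian ?\<phi>)"]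
    by (simp add: a_def[symmetric] power2_eq_square mult_ac)
  from sums_minus[OF this] have s2: "(\<lambda>j. ev j * (a j)\<^sup>2) sums L2_inner \<Omega> (laplacian ?\<phi>) (laplacian ?\<phi>)"
    by simp
  \<comment> \<open>Both series have the same squares (a j)^2, weighted by \<open>ev j\<close> and
    by 1, so the assumed bound compares them term by term.\<close>
  have "L2_inner \<Omega> (laplacian ?\<phi>) (laplacian ?\<phi>) \<le> b * L2_inner \<Omega> (grad ?\<phi>) (grad ?\<phi>)"
    by (rule sums_le[OF _ s2 sums_mult[OF s1]]) (simp add: b mult_right_mono)
  then have "4 * r\<^sup>2 * L2_inner \<Omega> (laplacian ?\<phi>) (laplacian ?\<phi>)
      \<le> 4 * r\<^sup>2 * (b * L2_inner \<Omega> (grad ?\<phi>) (grad ?\<phi>))" by (intro mult_left_mono) auto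
  with grad_le_laplacian[OF subset_refl r(1)]
  have "(1 - 4 * r\<^sup>2 * b) * L2_inner \<Omega> (grad ?\<phi>) (grad ?\<phi>) \<le> 0" by (simp add: algebra_simps)
  then have "L2_inner \<Omega> (grad ?\<phi>) (grad ?\<phi>) \<le> 0" using small by (simp add: mult_le_0_iff)
  \<comment> \<open>Poincare passes from the vanishing gradient to \<phi>, which would be zero
    almost everywhere although it is positive on a ball.\<close>
  then have "L2_inner \<Omega> ?\<phi> ?\<phi> \<le> 0"
    using Poincare[OF subset_refl] mult_nonneg_nonpos[of "4 * r\<^sup>2" "L2_inner \<Omega> (grad ?\<phi>) (grad ?\<phi>)"] by force
  then have "L2_inner \<Omega> ?\<phi> ?\<phi> = 0" using L2_inner_self_nonneg[of \<Omega> ?\<phi>] by simp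
  then have "AE x in lebesgue_on \<Omega>. ?\<phi> x = 0"
    using L2_inner_self_eq_0_iff[OF in_L2(1)] by (simp add: L2_eq_def)
  then have "AE x in lebesgue. x \<in> \<Omega> \<longrightarrow> ?\<phi> x = 0"
    using \<Omega>(1) by (subst (asm) AE_restrict_space_iff) auto
  then have "AE x in lebesgue. x \<notin> ball c r"
    by eventually_elim (use bump_pos[of _ c r 3] R r in \<open>force simp: subset_iff\<close>)
  then have "ball c r \<in> null_sets lebesgue"
    using AE_iff_null_sets[of "ball c r" lebesgue] by auto
  then have "negligible (ball c r)" by (simp add: negligible_iff_null_sets)
  moreover have "\<not> negligible (ball c r)"
    using r(1) by (intro open_not_negligible) auto
  ultimately show False by simp
qed

section \<open>The resolvent\<close>

text \<open>Far out the ratio is at least 1/2; the finitely many remaining indices contribute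
  positive ratios, and \<delta> is the minimum of them all. The summand 1 keeps the denominator
  positive and yields a bound from below on the distance itself.\<close>

lemma spectral_gap:
  fixes ev :: "nat \<Rightarrow> real"
  assumes nonneg: "\<And>j. 0 \<le> ev j" and mono: "\<And>j. ev j \<le> ev (Suc j)"
    and unbounded: "\<And>b. \<exists>j. b < ev j" and ne: "\<And>j. \<mu> \<noteq> ev j"
  shows "\<exists>\<delta>>0. \<forall>j. \<delta> * (1 + ev j) \<le> \<bar>\<mu> - ev j\<bar>"
proof -
  \<comment> \<open>If ev j > 2 |\<mu>| + 1, then |\<mu>| < (ev j - 1) / 2, and ev j - |\<mu>|
    exceeds (1 + ev j) / 2.\<close>
  obtain J where J: "2 * \<bar>\<mu>\<bar> + 1 < ev J" using unbounded by blast
  let ?D = "insert (1/2) ((\<lambda>j. \<bar>\<mu> - ev j\<bar> / (1 + ev j)) ` {..<J})"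
  have p: "1 + ev j > 0" for j using nonneg[of j] by simp
  have "Min ?D > 0" using p ne by (subst Min_gr_iff) auto
  moreover have "Min ?D * (1 + ev j) \<le> \<bar>\<mu> - ev j\<bar>" for j
  proof (cases "j < J")
    case True
    then have "Min ?D \<le> \<bar>\<mu> - ev j\<bar> / (1 + ev j)" by (intro Min_le) auto
    then show ?thesis using p[of j] by (simp add: pos_le_divide_eq)
  next
    case False
    then have "ev J \<le> ev j" using lift_Suc_mono_le[of ev, OF mono] by simp
    with J abs_triangle_ineq2[of "ev j" \<mu>] abs_ge_self[of "ev j"]
    have "1 / 2 * (1 + ev j) \<le> \<bar>\<mu> - ev j\<bar>" by (simp add: abs_minus_commute)
    moreover have "Min ?D * (1 + ev j) \<le> 1 / 2 * (1 + ev j)"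
      using p[of j] by (intro mult_right_mono Min_le) auto
    ultimately show ?thesis by linarith
  qed
  ultimately show ?thesis by blast
qed

lemma W_space_scaleR:
  assumes "b \<in> W_space \<Omega> m"
  shows "(\<lambda>x. c *\<^sub>R b x) \<in> W_space \<Omega> m"
proof -
  obtain r where r: "r 0 = b" "\<And>i. i \<le> m \<Longrightarrow> r i \<in> V0 \<Omega>" "\<And>i. i < m \<Longrightarrow> weak_rot \<Omega> (r i) (r (Suc i))"
    using assms by (auto simp: W_space_def)
  show ?thesis
    unfolding W_space_def mem_Collect_eq
  proof (intro exI[of _ "\<lambda>i x. c *\<^sub>R r i x"] conjI allI impI)
    show "(\<lambda>x. c *\<^sub>R r i x) \<in> V0 \<Omega>" if "i \<le> m" for i
      using orth_compl_scaleR r(2)[OF that] by (simp add: V0_def)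
    show "weak_rot \<Omega> (\<lambda>x. c *\<^sub>R r i x) (\<lambda>x. c *\<^sub>R r (Suc i) x)" if "i < m" for i
      using r(3)[OF that] by (auto simp: weak_rot_def L2_scaleR L2_inner_scaleR_left)
  qed (simp add: r(1))
qed

lemma W_space_subset_V0: "W_space \<Omega> m \<subseteq> V0 \<Omega>"
  by (auto simp: W_space_def)

lemma potential_fields_subset_L2: "potential_fields \<Omega> \<subseteq> L2 \<Omega>"
  by (auto simp: potential_fields_def)

text \<open>Here the spectral information is condensed into the gap: on coefficients the operator is
  multiplication by \<mu> - \<nu>_j^2, bounded away from zero.\<close>

locale grad_div_eigenbasis =
  fixes \<Omega> :: "(real^3) set" and q :: "nat \<Rightarrow> real^3 \<Rightarrow> real^3" and \<nu> :: "nat \<Rightarrow> real" and \<mu> \<delta> :: real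
  assumes lmeasurable: "\<Omega> \<in> lmeasurable"
    and basis: "orthonormal_basis \<Omega> (potential_fields \<Omega>) q"
    and \<delta>: "0 < \<delta>" and gap: "\<And>j. \<delta> * (1 + (\<nu> j)\<^sup>2) \<le> \<bar>\<mu> - (\<nu> j)\<^sup>2\<bar>"
begin

lemma q: "orthonormal_system \<Omega> q"
  using basis by (auto simp: orthonormal_basis_def orthonormal_system_def potential_fields_def)

lemma span: "closed_span \<Omega> q = potential_fields \<Omega>"
  using basis by (simp add: orthonormal_basis_def)

lemma resolvent_denominator: "\<mu> - (\<nu> j)\<^sup>2 \<noteq> 0"
proof -
  have "0 < \<delta> * (1 + (\<nu> j)\<^sup>2)" using \<delta> by (simp add: add_pos_nonneg)
  then show ?thesis using gap[of j] by auto
qed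

text \<open>Both 1 and \<nu>_j^2 are at most |\<mu> - \<nu>_j^2| / \<delta>. The first estimate
  makes the inverse bounded; the second is the gain of two orders of regularity.\<close>

lemma resolvent_bound:
  "(t / (\<mu> - (\<nu> j)\<^sup>2))\<^sup>2 \<le> t\<^sup>2 / \<delta>\<^sup>2" "\<nu> j ^ 4 * (t / (\<mu> - (\<nu> j)\<^sup>2))\<^sup>2 \<le> t\<^sup>2 / \<delta>\<^sup>2"
proof -
  let ?d = "\<mu> - (\<nu> j)\<^sup>2"
  have d: "?d\<^sup>2 > 0" using resolvent_denominator[of j] by simp
  have "\<delta> \<le> \<delta> * (1 + (\<nu> j)\<^sup>2)" "\<delta> * (\<nu> j)\<^sup>2 \<le> \<delta> * (1 + (\<nu> j)\<^sup>2)" using \<delta> by (simp_all add: algebra_simps)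
  then have le: "\<delta> \<le> \<bar>?d\<bar>" "\<delta> * (\<nu> j)\<^sup>2 \<le> \<bar>?d\<bar>" using gap[of j] by linarith+
  have "\<delta>\<^sup>2 \<le> \<bar>?d\<bar>\<^sup>2" "(\<delta> * (\<nu> j)\<^sup>2)\<^sup>2 \<le> \<bar>?d\<bar>\<^sup>2"
    by (rule power_mono[OF le(1)] power_mono[OF le(2)]; use \<delta> in simp)+
  then have *: "\<delta>\<^sup>2 \<le> ?d\<^sup>2" "\<delta>\<^sup>2 * \<nu> j ^ 4 \<le> ?d\<^sup>2" by (simp_all add: power_mult_distrib flip: power_mult)
  show "(t / ?d)\<^sup>2 \<le> t\<^sup>2 / \<delta>\<^sup>2"
    unfolding power_divide using *(1) d \<delta> by (intro divide_left_mono) auto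
  have "\<nu> j ^ 4 * (t / ?d)\<^sup>2 = t\<^sup>2 * \<nu> j ^ 4 / ?d\<^sup>2" by (simp add: power_divide)
  also have "\<dots> \<le> t\<^sup>2 / \<delta>\<^sup>2"
    using mult_left_mono[OF *(2), of "t\<^sup>2"] d \<delta> by (simp add: divide_le_eq pos_le_divide_eq field_simps)
  finally show "\<nu> j ^ 4 * (t / ?d)\<^sup>2 \<le> t\<^sup>2 / \<delta>\<^sup>2" .
qed

lemma Nd_closed_span:
  assumes u: "u \<in> A_space \<Omega> q \<nu> 2"
  shows "Nd \<Omega> q \<nu> u \<in> closed_span \<Omega> q" "L2_inner \<Omega> (Nd \<Omega> q \<nu> u) (q j) = - (\<nu> j)\<^sup>2 * L2_inner \<Omega> u (q j)"
proof -
  let ?c = "\<lambda>j. (\<nu> j)\<^sup>2 * L2_inner \<Omega> u (q j)"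
  \<comment> \<open>The squares are \<nu>_j^4 times squared coefficients, exactly the series in
    \<open>A_space\<close> at index 2.\<close>
  have "summable (\<lambda>j. (?c j)\<^sup>2)"
    using u by (simp add: A_space_def power_mult_distrib flip: power_mult)
  note s = L2_suminf_closed_span[OF q lmeasurable this]
  from closed_span_lincomb[OF q s(1) s(1), of "-1" 0] show "Nd \<Omega> q \<nu> u \<in> closed_span \<Omega> q"
    by (simp add: Nd_def)
  show "L2_inner \<Omega> (Nd \<Omega> q \<nu> u) (q j) = - (\<nu> j)\<^sup>2 * L2_inner \<Omega> u (q j)"
    using s(2)[of j] by (simp add: Nd_def L2_inner_uminus_left)
qed

lemma shifted_Nd_closed_span:
  assumes u: "u \<in> A_space \<Omega> q \<nu> 2"
  shows "(\<lambda>x. Nd \<Omega> q \<nu> u x + \<mu> *\<^sub>R u x) \<in> closed_span \<Omega> q"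
    "L2_inner \<Omega> (\<lambda>x. Nd \<Omega> q \<nu> u x + \<mu> *\<^sub>R u x) (q j) = (\<mu> - (\<nu> j)\<^sup>2) * L2_inner \<Omega> u (q j)"
proof -
  have us: "u \<in> closed_span \<Omega> q" using u by (simp add: A_space_def span)
  show "(\<lambda>x. Nd \<Omega> q \<nu> u x + \<mu> *\<^sub>R u x) \<in> closed_span \<Omega> q"
    using closed_span_lincomb[OF q Nd_closed_span(1)[OF u] us, of 1 \<mu>] by simp
  have "Nd \<Omega> q \<nu> u \<in> L2 \<Omega>" "u \<in> L2 \<Omega>" using Nd_closed_span(1)[OF u] us by (simp_all add: closed_span_def)
  then show "L2_inner \<Omega> (\<lambda>x. Nd \<Omega> q \<nu> u x + \<mu> *\<^sub>R u x) (q j) = (\<mu> - (\<nu> j)\<^sup>2) * L2_inner \<Omega> u (q j)"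
    by (simp add: L2_inner_add_left L2_scaleR orthonormal_L2[OF q] L2_inner_scaleR_left Nd_closed_span(2)[OF u] algebra_simps)
qed

lemma resolvent_coefficients:
  assumes u: "u \<in> A_space \<Omega> q \<nu> 2" and g: "g \<in> L2 \<Omega>"
    and eq: "L2_eq \<Omega> (\<lambda>x. Nd \<Omega> q \<nu> u x + \<mu> *\<^sub>R u x) g"
  shows "L2_inner \<Omega> u (q j) = L2_inner \<Omega> g (q j) / (\<mu> - (\<nu> j)\<^sup>2)"
proof -
  have "(\<lambda>x. Nd \<Omega> q \<nu> u x + \<mu> *\<^sub>R u x) \<in> L2 \<Omega>"
    using shifted_Nd_closed_span(1)[OF u] by (simp add: closed_span_def)
  from L2_inner_cong[OF eq this g orthonormal_L2[OF q]]
  show ?thesis using shifted_Nd_closed_span(2)[OF u] resolvent_denominator[of j] by (simp add: field_simps)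
qed

text \<open>Two right-hand sides are allowed because the orthogonal projections of \<open>f\<close>
  are fixed only up to null sets and each solution may bring its own.\<close>

lemma resolvent_unique:
  assumes "u \<in> A_space \<Omega> q \<nu> 2" "g \<in> L2 \<Omega>" "L2_eq \<Omega> (\<lambda>x. Nd \<Omega> q \<nu> u x + \<mu> *\<^sub>R u x) g"
    and "u' \<in> A_space \<Omega> q \<nu> 2" "g' \<in> L2 \<Omega>" "L2_eq \<Omega> (\<lambda>x. Nd \<Omega> q \<nu> u' x + \<mu> *\<^sub>R u' x) g'"
    and "L2_eq \<Omega> g g'"
  shows "L2_eq \<Omega> u u'"
proof (rule closed_span_eqI[OF q])
  show "u \<in> closed_span \<Omega> q" "u' \<in> closed_span \<Omega> q" using assms(1,4) by (simp_all add: A_space_def span)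
  show "L2_inner \<Omega> u (q j) = L2_inner \<Omega> u' (q j)" for j
    using resolvent_coefficients[OF assms(1-3)] resolvent_coefficients[OF assms(4-6)]
      L2_inner_cong[OF assms(7,2,5) orthonormal_L2[OF q]] by simp
qed

text \<open>The witness behind the choice is the series whose coefficients are those of
  \<open>g\<close> divided by \<mu> - \<nu>_j^2; the two bounds make it converge and place it in the
  domain.\<close>

lemma Nd_shift_inv:
  assumes g: "g \<in> potential_fields \<Omega>"
  shows "Nd_shift_inv \<Omega> q \<nu> \<mu> g \<in> A_space \<Omega> q \<nu> 2"
    and "L2_eq \<Omega> (\<lambda>x. Nd \<Omega> q \<nu> (Nd_shift_inv \<Omega> q \<nu> \<mu> g) x + \<mu> *\<^sub>R Nd_shift_inv \<Omega> q \<nu> \<mu> g x) g"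
proof -
  define c where "c j = L2_inner \<Omega> g (q j) / (\<mu> - (\<nu> j)\<^sup>2)" for j
  have gs: "g \<in> closed_span \<Omega> q" using g by (simp add: span)
  have s: "summable (\<lambda>j. (L2_inner \<Omega> g (q j))\<^sup>2 / \<delta>\<^sup>2)"
    by (rule summable_divide[OF closed_span_summable[OF q gs]])
  have "summable (\<lambda>j. (c j)\<^sup>2)"
    by (rule summable_comparison_test'[OF s]) (simp add: c_def resolvent_bound)
  note u = L2_suminf_closed_span[OF q lmeasurable this]
  let ?u = "L2_suminf \<Omega> (\<lambda>j y. c j *\<^sub>R q j y)"
  have "summable (\<lambda>j. \<nu> j ^ 4 * (c j)\<^sup>2)"
    by (rule summable_comparison_test'[OF s])
       (simp add: c_def resolvent_bound abs_mult del: power_divide)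
  then have uA: "?u \<in> A_space \<Omega> q \<nu> 2" using u by (simp add: A_space_def span)
  have "L2_eq \<Omega> (\<lambda>x. Nd \<Omega> q \<nu> ?u x + \<mu> *\<^sub>R ?u x) g"
    by (rule closed_span_eqI[OF q shifted_Nd_closed_span(1)[OF uA] gs])
       (simp only: shifted_Nd_closed_span(2)[OF uA] u(2), use resolvent_denominator in \<open>simp add: c_def\<close>)
  with uA have "\<exists>u. u \<in> A_space \<Omega> q \<nu> 2 \<and> L2_eq \<Omega> (\<lambda>x. Nd \<Omega> q \<nu> u x + \<mu> *\<^sub>R u x) g" by blast
  from someI_ex[OF this]
  show "Nd_shift_inv \<Omega> q \<nu> \<mu> g \<in> A_space \<Omega> q \<nu> 2"
    "L2_eq \<Omega> (\<lambda>x. Nd \<Omega> q \<nu> (Nd_shift_inv \<Omega> q \<nu> \<mu> g) x + \<mu> *\<^sub>R Nd_shift_inv \<Omega> q \<nu> \<mu> g x) g"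
    by (simp_all add: Nd_shift_inv_def)
qed

text \<open>Raising the index from 2k to 2k + 2 multiplies the weight by \<nu>_j^4, which the
  squared denominator absorbs. The field \<open>a\<close> is separate from \<open>g\<close> because
  membership in \<open>C_space\<close> yields a regular component that only agrees almost everywhere
  with the given projection.\<close>

lemma Nd_shift_inv_regularity:
  assumes g: "g \<in> potential_fields \<Omega>" and a: "a \<in> A_space \<Omega> q \<nu> (2 * k)" "L2_eq \<Omega> g a"
  shows "Nd_shift_inv \<Omega> q \<nu> \<mu> g \<in> A_space \<Omega> q \<nu> (2 * (k + 1))"
proof -
  let ?u = "Nd_shift_inv \<Omega> q \<nu> \<mu> g"
  have L: "g \<in> L2 \<Omega>" "a \<in> L2 \<Omega>" using g a(1) potential_fields_subset_L2 by (auto simp: A_space_def)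
  have c: "L2_inner \<Omega> ?u (q j) = L2_inner \<Omega> a (q j) / (\<mu> - (\<nu> j)\<^sup>2)" for j
    using resolvent_coefficients[OF Nd_shift_inv(1)[OF g] L(1) Nd_shift_inv(2)[OF g]]
      L2_inner_cong[OF a(2) L orthonormal_L2[OF q]] by simp
  have "summable (\<lambda>j. \<nu> j ^ (2 * (2 * k)) * (L2_inner \<Omega> a (q j))\<^sup>2)" using a(1) by (simp add: A_space_def)
  then have s: "summable (\<lambda>j. \<nu> j ^ (2 * (2 * k)) * (L2_inner \<Omega> a (q j))\<^sup>2 / \<delta>\<^sup>2)" by (rule summable_divide)
  have "summable (\<lambda>j. \<nu> j ^ (2 * (2 * (k + 1))) * (L2_inner \<Omega> ?u (q j))\<^sup>2)"
  proof (rule summable_comparison_test'[OF s])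
    fix j
    have pow: "\<nu> j ^ (2 * (2 * (k + 1))) = \<nu> j ^ (2 * (2 * k)) * \<nu> j ^ 4"
    proof -
      have "2 * (2 * (k + 1)) = 2 * (2 * k) + (4::nat)" by simp
      then show ?thesis by (simp only: power_add)
    qed
    have nn: "0 \<le> \<nu> j ^ (2 * n)" for n by (simp add: power_mult)
    have "\<nu> j ^ (2 * (2 * (k + 1))) * (L2_inner \<Omega> ?u (q j))\<^sup>2
        = \<nu> j ^ (2 * (2 * k)) * (\<nu> j ^ 4 * (L2_inner \<Omega> a (q j) / (\<mu> - (\<nu> j)\<^sup>2))\<^sup>2)"
      unfolding pow c by (simp only: mult.assoc)
    also have "\<dots> \<le> \<nu> j ^ (2 * (2 * k)) * ((L2_inner \<Omega> a (q j))\<^sup>2 / \<delta>\<^sup>2)"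
      by (rule mult_left_mono[OF resolvent_bound(2) nn])
    finally show "norm (\<nu> j ^ (2 * (2 * (k + 1))) * (L2_inner \<Omega> ?u (q j))\<^sup>2)
        \<le> \<nu> j ^ (2 * (2 * k)) * (L2_inner \<Omega> a (q j))\<^sup>2 / \<delta>\<^sup>2"
      using nn[of "2 * (k + 1)"] by (simp only: real_norm_def abs_of_nonneg mult_nonneg_nonneg zero_le_power2 times_divide_eq_right)
  qed
  then show ?thesis using Nd_shift_inv(1)[OF g] by (simp add: A_space_def)
qed

text \<open>The choice need not return the zero function, but all its coefficients vanish.\<close>

lemma Nd_shift_inv_zero:
  assumes g: "g \<in> potential_fields \<Omega>" and "L2_eq \<Omega> g (\<lambda>x. 0)"
  shows "L2_eq \<Omega> (Nd_shift_inv \<Omega> q \<nu> \<mu> g) (\<lambda>x. 0)"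
proof -
  let ?u = "Nd_shift_inv \<Omega> q \<nu> \<mu> g"
  have L: "g \<in> L2 \<Omega>" using g potential_fields_subset_L2 by auto
  have us: "?u \<in> closed_span \<Omega> q" using Nd_shift_inv(1)[OF g] by (simp add: A_space_def span)
  have "L2_inner \<Omega> ?u (q j) = 0" for j
    using resolvent_coefficients[OF Nd_shift_inv(1)[OF g] L Nd_shift_inv(2)[OF g]]
      L2_inner_cong[OF assms(2) L L2_zero orthonormal_L2[OF q]] by (simp add: L2_inner_zero_left)
  moreover have "(\<lambda>x. 0) \<in> closed_span \<Omega> q" using closed_span_lincomb[OF q us us, of 0 0] by simp
  ultimately show ?thesis by (intro closed_span_eqI[OF q us]) (simp_all add: L2_inner_zero_left)
qed

lemma A_space_cong:
  assumes "u \<in> A_space \<Omega> q \<nu> s" "w \<in> L2 \<Omega>" "L2_eq \<Omega> w u"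
  shows "w \<in> A_space \<Omega> q \<nu> s"
proof -
  have us: "u \<in> closed_span \<Omega> q" using assms(1) by (simp add: A_space_def span)
  then have "L2_inner \<Omega> w (q j) = L2_inner \<Omega> u (q j)" for j
    by (intro L2_inner_cong[OF assms(3,2) _ orthonormal_L2[OF q]]) (simp add: closed_span_def)
  then show ?thesis using assms(1) closed_span_cong[OF q us assms(2,3)] by (simp add: A_space_def span)
qed

end

section \<open>Solvability of the boundary value problem\<close>

theorem mainTheorem9:
  fixes \<Omega> :: "(real^3) set"
    and q :: "nat \<Rightarrow> real^3 \<Rightarrow> real^3"
    and \<nu> :: "nat \<Rightarrow> real"
    and \<mu> :: real
    and k m :: nat
    and f fA fV :: "real^3 \<Rightarrow> real^3"
  assumes domain: "smooth_ball_domain \<Omega>"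
    and basis: "orthonormal_basis \<Omega> (potential_fields \<Omega>) q"
    and q_smooth: "\<And>j. smooth_up_to_boundary \<Omega> (q j)"
    and q_eigen: "\<And>j x. x \<in> \<Omega> \<Longrightarrow> - grad (divg (q j)) x = (\<nu> j)\<^sup>2 *\<^sub>R q j x"
    and q_bdry: "\<And>j. tangential \<Omega> (q j)"
    and \<nu>_pos: "0 < (\<nu> 0)\<^sup>2"
    and \<nu>_mono: "\<And>j. (\<nu> j)\<^sup>2 \<le> (\<nu> (Suc j))\<^sup>2"
    and \<mu>_notin: "\<mu> \<notin> Sp_grad_div \<Omega>"
    and f_in: "f \<in> C_space \<Omega> q \<nu> (2 * k) m"
    and fA: "is_orth_proj \<Omega> (potential_fields \<Omega>) f fA"
    and fV: "is_orth_proj \<Omega> (V0 \<Omega>) f fV"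
  shows "\<exists>w. solves_problem \<Omega> q \<nu> \<mu> f w \<and>
    (\<forall>w'. solves_problem \<Omega> q \<nu> \<mu> f w' \<longrightarrow> L2_eq \<Omega> w' w) \<and>
    (\<exists>wA wV. is_orth_proj \<Omega> (potential_fields \<Omega>) w wA \<and> is_orth_proj \<Omega> (V0 \<Omega>) w wV \<and>
       L2_eq \<Omega> w (\<lambda>x. wA x + wV x) \<and>
       L2_eq \<Omega> wA (Nd_shift_inv \<Omega> q \<nu> \<mu> fA) \<and>
       L2_eq \<Omega> wV (\<lambda>x. inverse \<mu> *\<^sub>R fV x)) \<and>
    w \<in> C_space \<Omega> q \<nu> (2 * (k + 1)) m \<and>
    (fA \<in> potential_fields_\<gamma> \<Omega> \<and> L2_eq \<Omega> fV (\<lambda>x. 0) \<longrightarrow>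
       L2_eq \<Omega> w (Nd_shift_inv \<Omega> q \<nu> \<mu> fA) \<and> w \<in> A_space \<Omega> q \<nu> 2) \<and>
    (L2_eq \<Omega> fA (\<lambda>x. 0) \<and> fV \<in> V0 \<Omega> \<longrightarrow>
       L2_eq \<Omega> w (\<lambda>x. inverse \<mu> *\<^sub>R fV x))"
proof -
  let ?P = "potential_fields \<Omega>"
  have \<Omega>: "open \<Omega>" "bounded \<Omega>" "\<Omega> \<noteq> {}"
    using domain by (auto simp: smooth_ball_domain_def)
  have qC: "Ck_on 2 \<Omega> (q j)" for j
    using q_smooth[of j] closure_subset unfolding smooth_up_to_boundary_def smooth_on_def
    by (meson Ck_on_subset order_trans)
  have PL: "?P \<subseteq> L2 \<Omega>" by (rule potential_fields_subset_L2)
  have \<mu>0: "\<mu> \<noteq> 0" using zero_in_Sp_grad_div[OF \<Omega>(1,3)] \<mu>_notin by blast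
  \<comment> \<open>The unit norm of \<open>q j\<close> supplies the nonzero inner product that
    makes it a genuine eigenfield.\<close>
  have "\<mu> \<noteq> (\<nu> j)\<^sup>2" for j
    using eigenvalue_in_Sp_grad_div[OF q_smooth q_bdry _ q_eigen, of j] \<mu>_notin basis
    by (auto simp: orthonormal_basis_def)
  then obtain \<delta> where \<delta>: "0 < \<delta>" "\<And>j. \<delta> * (1 + (\<nu> j)\<^sup>2) \<le> \<bar>\<mu> - (\<nu> j)\<^sup>2\<bar>"
    using spectral_gap[of "\<lambda>j. (\<nu> j)\<^sup>2" \<mu>] \<nu>_mono eigenvalues_unbounded[OF \<Omega>(1,3) basis qC q_eigen] by auto
  interpret grad_div_eigenbasis \<Omega> q \<nu> \<mu> \<delta>
    using \<Omega> basis \<delta> by unfold_locales (auto intro: lmeasurable_open)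

  obtain a b where ab: "a \<in> A_space \<Omega> q \<nu> (2 * k)" "b \<in> W_space \<Omega> m" "L2_eq \<Omega> f (\<lambda>x. a x + b x)"
    and fL: "f \<in> L2 \<Omega>"
    using f_in by (auto simp: C_space_def)
  have aP: "a \<in> ?P" and bV: "b \<in> orth_compl \<Omega> ?P"
    using ab W_space_subset_V0 by (auto simp: A_space_def V0_def)
  note split_f = orth_decomposition_unique[OF PL aP bV ab(3) fL]
  have fAa: "L2_eq \<Omega> fA a" and fVb: "L2_eq \<Omega> fV b" using split_f fA fV by (auto simp: V0_def)
  have fAP: "fA \<in> ?P" and fVV: "fV \<in> V0 \<Omega>" using fA fV by (auto simp: is_orth_proj_def)
  have fAL: "fA \<in> L2 \<Omega>" using fAP PL by blast

  define wA where "wA = Nd_shift_inv \<Omega> q \<nu> \<mu> fA"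
  define wV where "wV = (\<lambda>x. inverse \<mu> *\<^sub>R fV x)"
  define w where "w = (\<lambda>x. wA x + wV x)"
  note wA = Nd_shift_inv[OF fAP, folded wA_def]
  have wAP: "wA \<in> ?P" using wA(1) by (simp add: A_space_def)
  have wVV: "wV \<in> V0 \<Omega>" using fVV unfolding wV_def V0_def by (rule orth_compl_scaleR)
  have VL: "V0 \<Omega> \<subseteq> L2 \<Omega>" unfolding V0_def by (rule orth_compl_subset_L2)
  have wL: "w \<in> L2 \<Omega>" unfolding w_def using wAP wVV PL VL by (intro L2_add) auto
  have pA: "is_orth_proj \<Omega> ?P w wA"
    using wAP wVV by (simp add: is_orth_proj_def w_def V0_def)
  have pV: "is_orth_proj \<Omega> (V0 \<Omega>) w wV"
    using wVV wAP subset_orth_compl_orth_compl[OF PL] by (auto simp: is_orth_proj_def w_def V0_def)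

  have "L2_eq \<Omega> (\<lambda>x. \<mu> *\<^sub>R wV x) fV" using \<mu>0 by (simp add: wV_def L2_eq_refl)
  then have solves: "solves_problem \<Omega> q \<nu> \<mu> f w"
    using fA fV pA pV wA wL unfolding solves_problem_def by blast

  have unique: "L2_eq \<Omega> w' w" if sol: "solves_problem \<Omega> q \<nu> \<mu> f w'" for w'
  proof -
    obtain fA' fV' wA' wV' where w'L: "w' \<in> L2 \<Omega>" and f': "is_orth_proj \<Omega> ?P f fA'" "is_orth_proj \<Omega> (V0 \<Omega>) f fV'"
      and w': "is_orth_proj \<Omega> ?P w' wA'" "is_orth_proj \<Omega> (V0 \<Omega>) w' wV'"
      and A': "wA' \<in> A_space \<Omega> q \<nu> 2" "L2_eq \<Omega> (\<lambda>x. Nd \<Omega> q \<nu> wA' x + \<mu> *\<^sub>R wA' x) fA'"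
      and V': "L2_eq \<Omega> (\<lambda>x. \<mu> *\<^sub>R wV' x) fV'"
      using sol unfolding solves_problem_def by blast
    \<comment> \<open>\<open>solves_problem\<close> quantifies over the projections of
      \<open>f\<close>; both pairs agree almost everywhere with the components \<open>a\<close> and
      \<open>b\<close>.\<close>
    have fa': "L2_eq \<Omega> fA' fA" "L2_eq \<Omega> fV' fV"
      using split_f[of fA' fV'] f' L2_eq_sym[OF fAa] L2_eq_sym[OF fVb] by (auto simp: V0_def intro: L2_eq_trans)
    have fA'L: "fA' \<in> L2 \<Omega>" using f'(1) PL by (auto simp: is_orth_proj_def)
    have "L2_eq \<Omega> wA' wA" by (rule resolvent_unique[OF A'(1) fA'L A'(2) wA(1) fAL wA(2) fa'(1)])
    moreover have "L2_eq \<Omega> wV' wV"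
      using L2_eq_scaleR[OF L2_eq_trans[OF V' fa'(2)], of "inverse \<mu>"] \<mu>0 by (simp add: wV_def)
    \<comment> \<open>The two projections of w' are given independently. Uniqueness of the
      decomposition identifies the second with w' - wA', so that w' is their sum almost
      everywhere.\<close>
    moreover have "L2_eq \<Omega> wV' (\<lambda>x. w' x - wA' x)"
      using orth_decomposition_unique(2)[OF PL _ _ _ w'L w'(1) w'(2)[unfolded V0_def], of wA' "\<lambda>x. w' x - wA' x"] w'(1)
      by (simp add: is_orth_proj_def L2_eq_refl)
    ultimately show ?thesis
      unfolding L2_eq_def w_def by eventually_elim (simp add: algebra_simps)
  qed

  \<comment> \<open>The second component is expressed through \<open>b\<close>, the representative
    known to lie in \<open>W_space\<close>.\<close>
  have "L2_eq \<Omega> w (\<lambda>x. wA x + inverse \<mu> *\<^sub>R b x)"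
    unfolding w_def wV_def by (intro L2_eq_add L2_eq_scaleR L2_eq_refl fVb)
  then have regular: "w \<in> C_space \<Omega> q \<nu> (2 * (k + 1)) m"
    unfolding C_space_def
    using wL Nd_shift_inv_regularity[OF fAP ab(1) fAa, folded wA_def] W_space_scaleR[OF ab(2), of "inverse \<mu>"]
    by (intro CollectI conjI bexI[of _ wA] bexI[of _ "\<lambda>x. inverse \<mu> *\<^sub>R b x"])

  have "L2_eq \<Omega> w wA \<and> w \<in> A_space \<Omega> q \<nu> 2" if "L2_eq \<Omega> fV (\<lambda>x. 0)"
  proof -
    have "L2_eq \<Omega> w wA"
      using that unfolding L2_eq_def w_def wV_def by eventually_elim simp
    then show ?thesis using A_space_cong[OF wA(1) wL] by blast
  qed
  moreover have "L2_eq \<Omega> w wV" if "L2_eq \<Omega> fA (\<lambda>x. 0)"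
    using Nd_shift_inv_zero[OF fAP that, folded wA_def]
    unfolding L2_eq_def w_def by eventually_elim simp
  ultimately show ?thesis
    using solves unique regular pA pV
    by (intro exI[of _ w] conjI exI[of _ wA] exI[of _ wV])
       (auto simp: w_def L2_eq_refl simp flip: wA_def wV_def)
qed

end
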